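(* Let $\mathcal S_n=(\mathcal V,(m_k)_{0\le k\le n})$ be a locally finite weighted $n$-simplicial (flag) complex. For $n$-simplices $\sigma,\sigma'$ define $$w(\sigma,\sigma')=\frac{\sqrt{m_n(\sigma)m_n(\sigma')}}{m_{n-1}(\sigma\cap\sigma')}\,\mathbf 1_{\{\sigma\sim\sigma'\}},\qquad V_n(\sigma)=\sum_{\tau\prec\sigma}\frac{m_n(\sigma)}{m_{n-1}(\tau)},$$ where $\sigma\sim\sigma'$ means that the underlying unoriented $n$-simplices are distinct and share an $(n-1)$-face (then unique and denoted $\sigma\cap\sigma'$), and $\tau\prec\sigma$ means that $\tau$ is one of the $n+1$ codimension-one faces of $\sigma$. These quantities depend only on the unoriented simplices. Assume (A1) $D(\sigma):=\sum_{\sigma'}w(\sigma,\sigma')$ (sum over unoriented $n$-simplices) is a bounded function of $\sigma$; (A2) $V_n$ is bounded. Then there exist a unitary $U:\ell^2(m_n)\to\ell^2(\widehat{\mathcal V})$, identifying unoriented $n$-simplices of $\mathcal S_n$ with the vertices of the line-complex (i.e. $U$ maps cochains supported on the orientations of $|\sigma|$ to functions supported at the vertex $|\sigma|$), and signs $\eta(\sigma,\sigma')=\eta(\sigma',\sigma)\in\{\pm1\}$ for $\sigma\sim\sigma'$, coming from the relative orientations of adjacent top simplices, such that $$U\Delta_nU^{-1}=\mathcal A_\eta+\mathcal Q(V_n),$$ where $(\mathcal A_\eta f)(\sigma)=\sum_{\sigma'\sim\sigma}\eta(\sigma,\sigma')w(\sigma,\sigma')f(\sigma')$ is a self-adjoint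 operator with real symmetric kernel of absolute value $w$, and $(\mathcal Q(V_n)f)(\sigma)=V_n(\sigma)f(\sigma)$. Consequently $\Delta_n$ is bounded with $$\|\Delta_n\|\le\|D\|_\infty+\|V_n\|_\infty,$$ and therefore extends uniquely to a bounded self-adjoint operator on $\ell^2(m_n)$; in particular $\Delta_n$ is essentially self-adjoint on $\mathcal C^n_c(\mathcal V)$.
   Context: Weighted graph: $\mathcal V$ is a countable set, $m_0:\mathcal V\to(0,\infty)$, and $m_1:\mathcal V^2\to[0,\infty)$ is symmetric and vanishes on the diagonal; $x\sim y$ iff $m_1(x,y)>0$, and $\mathcal N(x)=\{y:y\sim x\}$. Locally finite: every $\mathcal N(x)$ is finite. Weighted $n$-simplicial (flag) complex, $n\ge1$ fixed: $\mathcal F_k$ ($0\le k\le n$) is the set of ordered $(k+1)$-tuples of distinct pairwise adjacent vertices; $T_k$ (oriented $k$-simplices) is the set of classes $[x_0,\dots,x_k]$ of elements of $\mathcal F_k$ modulo even permutations; $|\sigma|=\{x_0,\dots,x_k\}$ is the underlying unoriented simplex. The weights $m_k:\mathcal V^{k+1}\to[0,\infty)$ are permutation invariant and positive exactly on $\mathcal F_k$. $F_{(x_1,\dots,x_k)}=\bigcap_j\mathcal N(x_j)$. Cochains: $\mathcal C^k(\mathcal V)$ is the space of $f:T_k\to\mathbb C$ with $f([x_{\pi(0)},\dots,x_{\pi(k)}])=\operatorname{sgn}(\pi)f([x_0,\dots,x_k])$ (all functions on $\mathcal V$ for $k=0$); $\mathcal C^k_c(\mathcal V)$ the finitely supported ones.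 $\ell^2(m_k)$: $k$-cochains with inner product $\frac1{(k+1)!}\sum_{\mathcal F_k}m_k f\overline g$. $d^nf([x_0,\dots,x_n])=\sum_{i=0}^n(-1)^if([x_0,\dots,\widehat{x_i},\dots,x_n])$; its formal adjoint is $\delta^ng([x_1,\dots,x_n])=\frac1{m_{n-1}(x_1,\dots,x_n)}\sum_{x_0\in F_{(x_1,\dots,x_n)}}m_n(x_0,\dots,x_n)g([x_0,x_1,\dots,x_n])$. The top-degree Hodge Laplacian is $\Delta_n=d^n\delta^n$, initially defined on $\mathcal C^n_c(\mathcal V)$. Line-complex: the graph whose vertex set $\widehat{\mathcal V}$ is the set of unoriented $n$-simplices, two distinct ones being adjacent iff they share an $(n-1)$-face. $\ell^2(\widehat{\mathcal V})$ carries the counting-measure inner product. Signs from relative orientations: after fixing a reference orientation of each unoriented $n$- and $(n-1)$-simplex, let $\theta(\tau,\sigma)\in\{\pm1\}$ (for $\tau\prec\sigma$) be the coefficient of $f(\tau_{\mathrm{ref}})$ in $(d^nf)(\sigma_{\mathrm{ref}})$; the sign in question is $\eta(\sigma,\sigma')=\theta(\sigma\cap\sigma',\sigma)\,\theta(\sigma\cap\sigma',\sigma')$. *)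

theory Defs
  imports "HOL-Analysis.Analysis" "HOL-Combinatorics.Permutations"
begin

section \<open>Weighted simplicial complexes\<close>

text \<open>
  A \<open>(k+1)\<close>-tuple of vertices is a list of length \<open>k + 1\<close>, so that the weight \<open>m\<^sub>k\<close> is
  \<open>m k :: 'v list \<Rightarrow> real\<close>. Only its values on lists of length \<open>k + 1\<close> with entries
  in \<open>V\<close> are ever constrained or used. The graph is given by \<open>m 1\<close>.
\<close>

definition adjacent :: "'v set \<Rightarrow> (nat \<Rightarrow> 'v list \<Rightarrow> real) \<Rightarrow> 'v \<Rightarrow> 'v \<Rightarrow> bool" where
  "adjacent V m x y \<longleftrightarrow> x \<in> V \<and> y \<in> V \<and> 0 < m 1 [x, y]"

definition neighbours :: "'v set \<Rightarrow> (nat \<Rightarrow> 'v list \<Rightarrow> real) \<Rightarrow> 'v \<Rightarrow> 'v set" where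
  "neighbours V m x = {y. adjacent V m y x}"

definition locally_finite :: "'v set \<Rightarrow> (nat \<Rightarrow> 'v list \<Rightarrow> real) \<Rightarrow> bool" where
  "locally_finite V m \<longleftrightarrow> (\<forall>x\<in>V. finite (neighbours V m x))"

definition ordered_simplices ::
  "'v set \<Rightarrow> (nat \<Rightarrow> 'v list \<Rightarrow> real) \<Rightarrow> nat \<Rightarrow> 'v list set" where
  "ordered_simplices V m k =
    {xs. length xs = Suc k \<and> set xs \<subseteq> V \<and> distinct xs \<and>
         (\<forall>x\<in>set xs. \<forall>y\<in>set xs. x \<noteq> y \<longrightarrow> adjacent V m x y)}"

locale weighted_complex =
  fixes V :: "'v set" and m :: "nat \<Rightarrow> 'v list \<Rightarrow> real" and n :: nat
  assumes countable_vertices: "countable V"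
    and dim_pos: "1 \<le> n"
    and vertex_weight_pos: "\<And>x. x \<in> V \<Longrightarrow> 0 < m 0 [x]"
    and edge_weight_nonneg: "\<And>x y. x \<in> V \<Longrightarrow> y \<in> V \<Longrightarrow> 0 \<le> m 1 [x, y]"
    and edge_weight_sym: "\<And>x y. x \<in> V \<Longrightarrow> y \<in> V \<Longrightarrow> m 1 [x, y] = m 1 [y, x]"
    and edge_weight_diag: "\<And>x. x \<in> V \<Longrightarrow> m 1 [x, x] = 0"
    and weight_nonneg:
      "\<And>k xs. k \<le> n \<Longrightarrow> length xs = Suc k \<Longrightarrow> set xs \<subseteq> V \<Longrightarrow> 0 \<le> m k xs"
    and weight_pos_iff:
      "\<And>k xs. k \<le> n \<Longrightarrow> length xs = Suc k \<Longrightarrow> set xs \<subseteq> V \<Longrightarrow>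
        0 < m k xs \<longleftrightarrow> xs \<in> ordered_simplices V m k"
    and weight_permute:
      "\<And>k xs \<pi>. k \<le> n \<Longrightarrow> length xs = Suc k \<Longrightarrow> set xs \<subseteq> V \<Longrightarrow>
        \<pi> permutes {..<Suc k} \<Longrightarrow> m k (permute_list \<pi> xs) = m k xs"

section \<open>Oriented and unoriented simplices\<close>

definition even_permutation_rel :: "('v list \<times> 'v list) set" where
  "even_permutation_rel =
    {(xs, permute_list \<pi> xs) | xs \<pi>. \<pi> permutes {..<length xs} \<and> evenperm \<pi>}"

text \<open>The class \<open>[x\<^sub>0, \<dots>, x\<^sub>k]\<close>; note
  \<open>permute_list \<pi> [x\<^sub>0, \<dots>, x\<^sub>k] = [x\<^bsub>\<pi> 0\<^esub>, \<dots>, x\<^bsub>\<pi> k\<^esub>]\<close>.\<close>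

definition oriented :: "'v list \<Rightarrow> 'v list set" where
  "oriented xs = even_permutation_rel `` {xs}"

definition oriented_simplices ::
  "'v set \<Rightarrow> (nat \<Rightarrow> 'v list \<Rightarrow> real) \<Rightarrow> nat \<Rightarrow> 'v list set set" where
  "oriented_simplices V m k = ordered_simplices V m k // even_permutation_rel"

text \<open>All representatives of an oriented simplex have the same set of entries.\<close>

definition underlying :: "'v list set \<Rightarrow> 'v set" where
  "underlying s = (\<Union>xs\<in>s. set xs)"

definition unoriented_simplices ::
  "'v set \<Rightarrow> (nat \<Rightarrow> 'v list \<Rightarrow> real) \<Rightarrow> nat \<Rightarrow> 'v set set" where
  "unoriented_simplices V m k = underlying ` oriented_simplices V m k"

definition representative :: "'v list set \<Rightarrow> 'v list" where
  "representative s = (SOME xs. xs \<in> s)"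

text \<open>The weight of an unoriented simplex; independent of the chosen enumeration because
  \<open>m k\<close> is permutation invariant (see \<open>simplex_weight_eq\<close>).\<close>

definition simplex_weight :: "(nat \<Rightarrow> 'v list \<Rightarrow> real) \<Rightarrow> nat \<Rightarrow> 'v set \<Rightarrow> real" where
  "simplex_weight m k \<sigma> = m k (SOME xs. distinct xs \<and> set xs = \<sigma>)"

definition facets :: "'v set \<Rightarrow> 'v set set" where
  "facets \<sigma> = (\<lambda>x. \<sigma> - {x}) ` \<sigma>"

definition reference_orientation ::
  "'v set \<Rightarrow> (nat \<Rightarrow> 'v list \<Rightarrow> real) \<Rightarrow> nat \<Rightarrow> ('v set \<Rightarrow> 'v list set) \<Rightarrow> bool" where
  "reference_orientation V m n \<omega> \<longleftrightarrow>
    (\<forall>k\<in>{n - 1, n}. \<forall>\<sigma>\<in>unoriented_simplices V m k.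
       \<omega> \<sigma> \<in> oriented_simplices V m k \<and> underlying (\<omega> \<sigma>) = \<sigma>)"

section \<open>Cochains and the top-degree Hodge Laplacian\<close>

text \<open>A function on a set of simplices is represented by its extension by zero.\<close>

definition cochains ::
  "'v set \<Rightarrow> (nat \<Rightarrow> 'v list \<Rightarrow> real) \<Rightarrow> nat \<Rightarrow> ('v list set \<Rightarrow> complex) set" where
  "cochains V m k =
    {f. (\<forall>s. s \<notin> oriented_simplices V m k \<longrightarrow> f s = 0) \<and>
        (\<forall>xs\<in>ordered_simplices V m k. \<forall>\<pi>. \<pi> permutes {..<Suc k} \<longrightarrow>
           f (oriented (permute_list \<pi> xs)) = of_int (sign \<pi>) * f (oriented xs))}"

definition finite_cochains ::
  "'v set \<Rightarrow> (nat \<Rightarrow> 'v list \<Rightarrow> real) \<Rightarrow> nat \<Rightarrow> ('v list set \<Rightarrow> complex) set" where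
  "finite_cochains V m k = {f \<in> cochains V m k. finite {s. f s \<noteq> 0}}"

text \<open>On cochains, the two formulas below do not depend on the representative.\<close>

definition coboundary ::
  "'v set \<Rightarrow> (nat \<Rightarrow> 'v list \<Rightarrow> real) \<Rightarrow> nat
    \<Rightarrow> ('v list set \<Rightarrow> complex) \<Rightarrow> 'v list set \<Rightarrow> complex" where
  "coboundary V m n f s =
    (if s \<in> oriented_simplices V m n
     then let xs = representative s
          in \<Sum>i=0..n. (-1) ^ i * f (oriented (take i xs @ drop (Suc i) xs))
     else 0)"

definition codifferential ::
  "'v set \<Rightarrow> (nat \<Rightarrow> 'v list \<Rightarrow> real) \<Rightarrow> nat
    \<Rightarrow> ('v list set \<Rightarrow> complex) \<Rightarrow> 'v list set \<Rightarrow> complex" where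
  "codifferential V m n g t =
    (if t \<in> oriented_simplices V m (n - 1)
     then let ys = representative t
          in 1 / of_real (m (n - 1) ys) *
             (\<Sum>x\<in>(\<Inter>y\<in>set ys. neighbours V m y).
                of_real (m n (x # ys)) * g (oriented (x # ys)))
     else 0)"

definition hodge_laplacian ::
  "'v set \<Rightarrow> (nat \<Rightarrow> 'v list \<Rightarrow> real) \<Rightarrow> nat
    \<Rightarrow> ('v list set \<Rightarrow> complex) \<Rightarrow> 'v list set \<Rightarrow> complex" where
  "hodge_laplacian V m n f = coboundary V m n (codifferential V m n f)"

text \<open>\<open>\<theta> \<tau> \<sigma>\<close> is the coefficient of \<open>f (\<omega> \<tau>)\<close> in \<open>(d\<^sup>n f) (\<omega> \<sigma>)\<close>; these equations determine
  \<open>\<theta> \<tau> \<sigma>\<close> whenever \<open>\<tau>\<close> is a facet of \<open>\<sigma>\<close>.\<close>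

definition coboundary_coefficients ::
  "'v set \<Rightarrow> (nat \<Rightarrow> 'v list \<Rightarrow> real) \<Rightarrow> nat \<Rightarrow> ('v set \<Rightarrow> 'v list set)
    \<Rightarrow> ('v set \<Rightarrow> 'v set \<Rightarrow> real) \<Rightarrow> bool" where
  "coboundary_coefficients V m n \<omega> \<theta> \<longleftrightarrow>
    (\<forall>\<sigma>\<in>unoriented_simplices V m n.
       (\<forall>\<tau>\<in>facets \<sigma>. \<theta> \<tau> \<sigma> \<in> {-1, 1}) \<and>
       (\<forall>f\<in>cochains V m (n - 1).
          coboundary V m n f (\<omega> \<sigma>) = (\<Sum>\<tau>\<in>facets \<sigma>. of_real (\<theta> \<tau> \<sigma>) * f (\<omega> \<tau>))))"

section \<open>The line-complex\<close>

definition line_adjacent ::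
  "'v set \<Rightarrow> (nat \<Rightarrow> 'v list \<Rightarrow> real) \<Rightarrow> nat \<Rightarrow> 'v set \<Rightarrow> 'v set \<Rightarrow> bool" where
  "line_adjacent V m n \<sigma> \<sigma>' \<longleftrightarrow>
    \<sigma> \<in> unoriented_simplices V m n \<and> \<sigma>' \<in> unoriented_simplices V m n \<and>
    \<sigma> \<noteq> \<sigma>' \<and> facets \<sigma> \<inter> facets \<sigma>' \<noteq> {}"

definition line_weight ::
  "'v set \<Rightarrow> (nat \<Rightarrow> 'v list \<Rightarrow> real) \<Rightarrow> nat \<Rightarrow> 'v set \<Rightarrow> 'v set \<Rightarrow> real" where
  "line_weight V m n \<sigma> \<sigma>' =
    (if line_adjacent V m n \<sigma> \<sigma>'
     then sqrt (simplex_weight m n \<sigma> * simplex_weight m n \<sigma>')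
          / simplex_weight m (n - 1) (\<sigma> \<inter> \<sigma>')
     else 0)"

definition line_degree ::
  "'v set \<Rightarrow> (nat \<Rightarrow> 'v list \<Rightarrow> real) \<Rightarrow> nat \<Rightarrow> 'v set \<Rightarrow> real" where
  "line_degree V m n \<sigma> = (\<Sum>\<^sub>\<infinity>\<sigma>'\<in>unoriented_simplices V m n. line_weight V m n \<sigma> \<sigma>')"

definition simplex_potential :: "(nat \<Rightarrow> 'v list \<Rightarrow> real) \<Rightarrow> nat \<Rightarrow> 'v set \<Rightarrow> real" where
  "simplex_potential m n \<sigma> =
    (\<Sum>\<tau>\<in>facets \<sigma>. simplex_weight m n \<sigma> / simplex_weight m (n - 1) \<tau>)"

definition signed_kernel ::
  "'v set \<Rightarrow> (nat \<Rightarrow> 'v list \<Rightarrow> real) \<Rightarrow> nat \<Rightarrow> ('v set \<Rightarrow> 'v set \<Rightarrow> real)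
    \<Rightarrow> 'v set \<Rightarrow> 'v set \<Rightarrow> real" where
  "signed_kernel V m n \<eta> \<sigma> \<sigma>' = \<eta> \<sigma> \<sigma>' * line_weight V m n \<sigma> \<sigma>'"

definition signed_adjacency ::
  "'v set \<Rightarrow> (nat \<Rightarrow> 'v list \<Rightarrow> real) \<Rightarrow> nat \<Rightarrow> ('v set \<Rightarrow> 'v set \<Rightarrow> real)
    \<Rightarrow> ('v set \<Rightarrow> complex) \<Rightarrow> 'v set \<Rightarrow> complex" where
  "signed_adjacency V m n \<eta> f \<sigma> =
    (\<Sum>\<sigma>' | line_adjacent V m n \<sigma>' \<sigma>. of_real (signed_kernel V m n \<eta> \<sigma> \<sigma>') * f \<sigma>')"

definition multiplication :: "('a \<Rightarrow> real) \<Rightarrow> ('a \<Rightarrow> complex) \<Rightarrow> 'a \<Rightarrow> complex" where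
  "multiplication q f x = of_real (q x) * f x"

text \<open>Supremum norm over \<open>S\<close>; inserting \<open>0\<close> gives the empty supremum the value \<open>0\<close>.\<close>

definition sup_norm :: "'a set \<Rightarrow> ('a \<Rightarrow> real) \<Rightarrow> real" where
  "sup_norm S g = Sup (insert 0 ((\<lambda>x. \<bar>g x\<bar>) ` S))"

section \<open>Operators on spaces of square-summable functions\<close>

record 'a inner_space =
  vecs :: "('a \<Rightarrow> complex) set"
  ip :: "('a \<Rightarrow> complex) \<Rightarrow> ('a \<Rightarrow> complex) \<Rightarrow> complex"

definition l2_cochains ::
  "'v set \<Rightarrow> (nat \<Rightarrow> 'v list \<Rightarrow> real) \<Rightarrow> nat \<Rightarrow> 'v list set inner_space" where
  "l2_cochains V m k =
    \<lparr> vecs = {f \<in> cochains V m k.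
                (\<lambda>xs. m k xs * (cmod (f (oriented xs)))\<^sup>2) summable_on ordered_simplices V m k},
      ip = (\<lambda>f g. 1 / fact (k + 1) *
                (\<Sum>\<^sub>\<infinity>xs\<in>ordered_simplices V m k.
                   of_real (m k xs) * f (oriented xs) * cnj (g (oriented xs)))) \<rparr>"

definition l2_counting :: "'a set \<Rightarrow> 'a inner_space" where
  "l2_counting S =
    \<lparr> vecs = {f. (\<forall>x. x \<notin> S \<longrightarrow> f x = 0) \<and> (\<lambda>x. (cmod (f x))\<^sup>2) summable_on S},
      ip = (\<lambda>f g. \<Sum>\<^sub>\<infinity>x\<in>S. f x * cnj (g x)) \<rparr>"

definition vnorm :: "'a inner_space \<Rightarrow> ('a \<Rightarrow> complex) \<Rightarrow> real" where
  "vnorm H f = sqrt (Re (ip H f f))"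

definition linear_on ::
  "('a \<Rightarrow> complex) set \<Rightarrow> (('a \<Rightarrow> complex) \<Rightarrow> 'b \<Rightarrow> complex) \<Rightarrow> bool" where
  "linear_on D A \<longleftrightarrow>
    (\<lambda>x. 0) \<in> D \<and>
    (\<forall>f\<in>D. \<forall>g\<in>D. \<forall>a b. (\<lambda>x. a * f x + b * g x) \<in> D \<and>
       A (\<lambda>x. a * f x + b * g x) = (\<lambda>y. a * A f y + b * A g y))"

text \<open>In the following, \<open>A\<close> is an operator in \<open>H\<close> with domain \<open>D\<close>; its values outside \<open>D\<close> are
  irrelevant.\<close>

definition linear_operator ::
  "'a inner_space \<Rightarrow> ('a \<Rightarrow> complex) set \<Rightarrow> (('a \<Rightarrow> complex) \<Rightarrow> 'a \<Rightarrow> complex) \<Rightarrow> bool" where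
  "linear_operator H D A \<longleftrightarrow> D \<subseteq> vecs H \<and> A ` D \<subseteq> vecs H \<and> linear_on D A"

definition bounded_operator ::
  "'a inner_space \<Rightarrow> ('a \<Rightarrow> complex) set \<Rightarrow> (('a \<Rightarrow> complex) \<Rightarrow> 'a \<Rightarrow> complex) \<Rightarrow> bool" where
  "bounded_operator H D A \<longleftrightarrow>
    linear_operator H D A \<and> (\<exists>C. \<forall>f\<in>D. vnorm H (A f) \<le> C * vnorm H f)"

definition op_norm ::
  "'a inner_space \<Rightarrow> ('a \<Rightarrow> complex) set \<Rightarrow> (('a \<Rightarrow> complex) \<Rightarrow> 'a \<Rightarrow> complex) \<Rightarrow> real" where
  "op_norm H D A = Sup {vnorm H (A f) | f. f \<in> D \<and> vnorm H f \<le> 1}"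

definition bounded_extension ::
  "'a inner_space \<Rightarrow> ('a \<Rightarrow> complex) set \<Rightarrow> (('a \<Rightarrow> complex) \<Rightarrow> 'a \<Rightarrow> complex)
    \<Rightarrow> (('a \<Rightarrow> complex) \<Rightarrow> 'a \<Rightarrow> complex) \<Rightarrow> bool" where
  "bounded_extension H D A B \<longleftrightarrow> bounded_operator H (vecs H) B \<and> (\<forall>f\<in>D. B f = A f)"

definition unitary ::
  "'a inner_space \<Rightarrow> 'b inner_space \<Rightarrow> (('a \<Rightarrow> complex) \<Rightarrow> 'b \<Rightarrow> complex) \<Rightarrow> bool" where
  "unitary H K U \<longleftrightarrow>
    bij_betw U (vecs H) (vecs K) \<and> linear_on (vecs H) U \<and>
    (\<forall>f\<in>vecs H. \<forall>g\<in>vecs H. ip K (U f) (U g) = ip H f g)"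

definition op_graph ::
  "('a \<Rightarrow> complex) set \<Rightarrow> (('a \<Rightarrow> complex) \<Rightarrow> 'a \<Rightarrow> complex)
    \<Rightarrow> (('a \<Rightarrow> complex) \<times> ('a \<Rightarrow> complex)) set" where
  "op_graph D A = {(f, A f) | f. f \<in> D}"

definition adjoint_graph ::
  "'a inner_space \<Rightarrow> (('a \<Rightarrow> complex) \<times> ('a \<Rightarrow> complex)) set
    \<Rightarrow> (('a \<Rightarrow> complex) \<times> ('a \<Rightarrow> complex)) set" where
  "adjoint_graph H G =
    {(u, v). u \<in> vecs H \<and> v \<in> vecs H \<and> (\<forall>(f, g)\<in>G. ip H g u = ip H f v)}"

definition closure_graph ::
  "'a inner_space \<Rightarrow> (('a \<Rightarrow> complex) \<times> ('a \<Rightarrow> complex)) set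
    \<Rightarrow> (('a \<Rightarrow> complex) \<times> ('a \<Rightarrow> complex)) set" where
  "closure_graph H G =
    {(u, v). u \<in> vecs H \<and> v \<in> vecs H \<and>
       (\<forall>e>0. \<exists>(f, g)\<in>G. vnorm H (\<lambda>x. u x - f x) < e \<and> vnorm H (\<lambda>x. v x - g x) < e)}"

definition dense_in :: "'a inner_space \<Rightarrow> ('a \<Rightarrow> complex) set \<Rightarrow> bool" where
  "dense_in H D \<longleftrightarrow>
    D \<subseteq> vecs H \<and> (\<forall>u\<in>vecs H. \<forall>e>0. \<exists>f\<in>D. vnorm H (\<lambda>x. u x - f x) < e)"

text \<open>Density of the domain makes the adjoint graph, hence \<open>G\<close> itself, single-valued.\<close>

definition self_adjoint_graph ::
  "'a inner_space \<Rightarrow> (('a \<Rightarrow> complex) \<times> ('a \<Rightarrow> complex)) set \<Rightarrow> bool" where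
  "self_adjoint_graph H G \<longleftrightarrow> dense_in H (Domain G) \<and> adjoint_graph H G = G"

definition self_adjoint ::
  "'a inner_space \<Rightarrow> ('a \<Rightarrow> complex) set \<Rightarrow> (('a \<Rightarrow> complex) \<Rightarrow> 'a \<Rightarrow> complex) \<Rightarrow> bool" where
  "self_adjoint H D A \<longleftrightarrow> linear_operator H D A \<and> self_adjoint_graph H (op_graph D A)"

definition essentially_self_adjoint ::
  "'a inner_space \<Rightarrow> ('a \<Rightarrow> complex) set \<Rightarrow> (('a \<Rightarrow> complex) \<Rightarrow> 'a \<Rightarrow> complex) \<Rightarrow> bool" where
  "essentially_self_adjoint H D A \<longleftrightarrow>
    linear_operator H D A \<and> self_adjoint_graph H (closure_graph H (op_graph D A))"

section \<open>Well-definedness\<close>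

lemma (in weighted_complex) simplex_weight_eq:
  assumes "k \<le> n" and xs: "xs \<in> ordered_simplices V m k"
  shows "simplex_weight m k (set xs) = m k xs"
proof -
  have d: "distinct xs" "length xs = Suc k" "set xs \<subseteq> V"
    using xs by (auto simp: ordered_simplices_def)
  define ys where "ys = (SOME ys. distinct ys \<and> set ys = set xs)"
  have "distinct ys \<and> set ys = set xs"
    unfolding ys_def by (rule someI[of _ xs]) (use d in simp)
  then have "mset ys = mset xs"
    using d set_eq_iff_mset_eq_distinct by blast
  then obtain \<pi> where "\<pi> permutes {..<length xs}" "permute_list \<pi> xs = ys"
    by (metis mset_eq_permutation)
  then show ?thesis
    using weight_permute[OF assms(1) d(2,3)] d(2) unfolding simplex_weight_def ys_def[symmetric] by metis
qed

lemma (in weighted_complex) reference_orientation_exists: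
  "\<exists>\<omega>. reference_orientation V m n \<omega>"
proof -
  have card: "finite \<sigma> \<and> card \<sigma> = Suc k" if "\<sigma> \<in> unoriented_simplices V m k" for \<sigma> k
  proof -
    from that obtain xs where xs: "xs \<in> ordered_simplices V m k" "\<sigma> = underlying (oriented xs)"
      by (auto simp: unoriented_simplices_def oriented_simplices_def quotient_def oriented_def)
    have "xs \<in> oriented xs"
      unfolding oriented_def even_permutation_rel_def
      by (auto intro!: exI[of _ id] simp: permutes_id evenperm_id)
    then have "\<sigma> = set xs"
      using xs(2) by (auto simp: underlying_def oriented_def even_permutation_rel_def)
    then show ?thesis
      using xs(1) by (auto simp: ordered_simplices_def distinct_card)
  qed
  define \<omega> where "\<omega> \<sigma> = (SOME s. s \<in> oriented_simplices V m (card \<sigma> - 1) \<and> underlying s = \<sigma>)" for \<sigma>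
  have "\<omega> \<sigma> \<in> oriented_simplices V m k \<and> underlying (\<omega> \<sigma>) = \<sigma>"
    if "\<sigma> \<in> unoriented_simplices V m k" for \<sigma> k
  proof -
    have "\<exists>s. s \<in> oriented_simplices V m k \<and> underlying s = \<sigma>"
      using that by (auto simp: unoriented_simplices_def)
    then show ?thesis
      unfolding \<omega>_def using card[OF that] by simp (rule someI_ex)
  qed
  then show ?thesis
    unfolding reference_orientation_def by blast
qed

end

theory Submission
  imports Defs
begin

text \<open>
  In top degree the Hodge Laplacian is \<open>d \<delta>\<close>, and its value at a simplex \<open>\<sigma>\<close> is a sum over paths
  \<open>\<sigma> \<succ> \<tau> \<prec> \<sigma>'\<close> that go down to a facet and up again. Once a reference orientation of every simplex is
  fixed, a cochain is a function on unoriented simplices (\<open>cochain_eq\<close>), and \<open>d\<close> and \<open>\<delta>\<close> become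
  sums weighted by incidence numbers \<open>\<plusminus>1\<close> (\<open>coboundary_reference\<close>, \<open>codifferential_reference\<close>).
  The incidence number of \<open>\<tau>\<close> in \<open>\<sigma>\<close> compares the orientations after the vertex opposite to \<open>\<tau>\<close> is put
  in front; it absorbs the alternating signs of the coboundary.

  The unitary multiplies the value at the reference orientation of \<open>\<sigma>\<close> by \<open>sqrt (m\<^sub>n \<sigma>)\<close>. The
  normalisation \<open>1 / (n + 1)!\<close> of the inner product compensates the number of orderings of a simplex,
  so this map is isometric onto the square-summable functions on the line-complex. Under it, a path
  that returns to \<open>\<sigma>\<close> has sign \<open>1\<close> and contributes to the potential. A path to a different
  simplex \<open>\<sigma>'\<close> can only pass through \<open>\<tau> = \<sigma> \<inter> \<sigma>'\<close>; its sign is the product of two incidence numbers and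
  its weight is the symmetric \<open>w (\<sigma>, \<sigma>')\<close>. This is \<open>to_line_hodge_laplacian\<close>.

  What remains is functional analysis of a real symmetric kernel with finite rows. Its absolute row
  sums are bounded by \<open>\<parallel>D\<parallel>\<^sub>\<infinity> + \<parallel>V\<parallel>\<^sub>\<infinity>\<close>, and the Schur test (\<open>kernel_operator_l2\<close>) turns this into a
  bound on the operator norm. So the Laplacian on finitely supported cochains is the restriction to a
  dense subspace of an everywhere defined bounded symmetric operator. Such an operator is
  self-adjoint (\<open>self_adjoint_graph_B\<close>) and its graph is the closure of that of the restriction
  (\<open>closure_graph_A\<close>).
\<close>

section \<open>Bounded symmetric operators on spaces of functions\<close>

text \<open>A complex vector space of functions with an inner product, linear in the first argument.
  Extensions of densely defined operators are exhibited by a formula instead of being constructed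
  from limits.\<close>

locale inner_product_functions =
  fixes H :: "'a inner_space"
  assumes zero_mem: "(\<lambda>x. 0) \<in> vecs H"
    and lincomb_mem:
      "\<And>f g a b. f \<in> vecs H \<Longrightarrow> g \<in> vecs H \<Longrightarrow> (\<lambda>x. a * f x + b * g x) \<in> vecs H"
    and ip_lincomb:
      "\<And>f g h a b. f \<in> vecs H \<Longrightarrow> g \<in> vecs H \<Longrightarrow> h \<in> vecs H \<Longrightarrow>
        ip H (\<lambda>x. a * f x + b * g x) h = a * ip H f h + b * ip H g h"
    and ip_swap: "\<And>f g. f \<in> vecs H \<Longrightarrow> g \<in> vecs H \<Longrightarrow> ip H g f = cnj (ip H f g)"
    and ip_self_nonneg: "\<And>f. f \<in> vecs H \<Longrightarrow> 0 \<le> Re (ip H f f)"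
    and ip_self_zero: "\<And>f. f \<in> vecs H \<Longrightarrow> Re (ip H f f) = 0 \<Longrightarrow> f = (\<lambda>x. 0)"
begin

lemma diff_mem: "f \<in> vecs H \<Longrightarrow> g \<in> vecs H \<Longrightarrow> (\<lambda>x. f x - g x) \<in> vecs H"
  using lincomb_mem[of f g 1 "-1"] by simp

lemma add_mem: "f \<in> vecs H \<Longrightarrow> g \<in> vecs H \<Longrightarrow> (\<lambda>x. f x + g x) \<in> vecs H"
  using lincomb_mem[of f g 1 1] by simp

lemma ip_lincomb_right:
  assumes "f \<in> vecs H" "g \<in> vecs H" "h \<in> vecs H"
  shows "ip H h (\<lambda>x. a * f x + b * g x) = cnj a * ip H h f + cnj b * ip H h g"
proof -
  have "ip H h (\<lambda>x. a * f x + b * g x) = cnj (ip H (\<lambda>x. a * f x + b * g x) h)"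
    using assms by (intro ip_swap lincomb_mem)
  also have "\<dots> = cnj a * cnj (ip H f h) + cnj b * cnj (ip H g h)"
    using assms by (simp add: ip_lincomb)
  also have "\<dots> = cnj a * ip H h f + cnj b * ip H h g"
    using ip_swap assms by metis
  finally show ?thesis .
qed

lemma ip_diff_right:
  assumes "f \<in> vecs H" "g \<in> vecs H" "h \<in> vecs H"
  shows "ip H h (\<lambda>x. f x - g x) = ip H h f - ip H h g"
  using ip_lincomb_right[OF assms, of 1 "-1"] by simp

lemma vnorm_nonneg: "f \<in> vecs H \<Longrightarrow> 0 \<le> vnorm H f"
  by (simp add: vnorm_def ip_self_nonneg)

lemma vnorm_power2: "f \<in> vecs H \<Longrightarrow> (vnorm H f)\<^sup>2 = Re (ip H f f)"
  by (simp add: vnorm_def ip_self_nonneg)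

lemma vnorm_eq_0D: "f \<in> vecs H \<Longrightarrow> vnorm H f = 0 \<Longrightarrow> f = (\<lambda>x. 0)"
  by (simp add: vnorm_def ip_self_zero)

lemma parallelogram:
  assumes "f \<in> vecs H" "g \<in> vecs H"
  shows "(vnorm H (\<lambda>x. f x - g x))\<^sup>2 + (vnorm H (\<lambda>x. f x + g x))\<^sup>2
    = 2 * (vnorm H f)\<^sup>2 + 2 * (vnorm H g)\<^sup>2"
proof -
  have lc: "ip H (\<lambda>x. f x + c * g x) (\<lambda>x. f x + c * g x) =
      ip H f f + cnj c * ip H f g + c * ip H g f + c * cnj c * ip H g g" for c
    using assms ip_lincomb[OF assms lincomb_mem[OF assms], of 1 c 1 c]
      ip_lincomb_right[OF assms assms(1), of 1 c] ip_lincomb_right[OF assms assms(2), of 1 c]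
    by (simp add: algebra_simps)
  show ?thesis
    using lc[of 1] lc[of "-1"] assms by (simp add: vnorm_power2 diff_mem add_mem)
qed

text \<open>The parallelogram law gives a triangle inequality in this form; a factor of two is harmless in
  limit arguments.\<close>

lemma vnorm_diff_less:
  assumes "f \<in> vecs H" "g \<in> vecs H" "vnorm H f < e" "vnorm H g < e"
  shows "vnorm H (\<lambda>x. f x - g x) < 2 * e"
proof -
  have e: "0 < e" using vnorm_nonneg[OF assms(1)] assms(3) by linarith
  have "(vnorm H f)\<^sup>2 < e\<^sup>2" "(vnorm H g)\<^sup>2 < e\<^sup>2"
    using assms by (auto intro!: power_strict_mono vnorm_nonneg)
  then have "(vnorm H (\<lambda>x. f x - g x))\<^sup>2 < 4 * e\<^sup>2"
    using parallelogram[OF assms(1,2)] zero_le_power2[of "vnorm H (\<lambda>x. f x + g x)"] by linarith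
  then have "(vnorm H (\<lambda>x. f x - g x))\<^sup>2 < (2 * e)\<^sup>2"
    by (simp add: power_mult_distrib)
  then show ?thesis
    using e by (meson less_eq_real_def mult_pos_pos power2_less_imp_less zero_less_numeral)
qed

lemma zero_if_vnorm_small:
  assumes "f \<in> vecs H" "\<And>e. 0 < e \<Longrightarrow> vnorm H f < e"
  shows "f = (\<lambda>x. 0)"
proof (rule ccontr)
  assume "f \<noteq> (\<lambda>x. 0)"
  then have "0 < vnorm H f"
    using vnorm_eq_0D[OF assms(1)] vnorm_nonneg[OF assms(1)] by fastforce
  then show False using assms(2) by blast
qed

lemma eq_if_vnorm_diff_small:
  assumes "f \<in> vecs H" "g \<in> vecs H" "\<And>e. 0 < e \<Longrightarrow> vnorm H (\<lambda>x. f x - g x) < e"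
  shows "f = g"
proof -
  have "(\<lambda>x. f x - g x) = (\<lambda>x. 0)"
    using assms by (intro zero_if_vnorm_small diff_mem)
  then show ?thesis by (metis (no_types) eq_iff_diff_eq_0 ext)
qed

end

lemma linear_on_diff:
  assumes "linear_on D A" "f \<in> D" "g \<in> D"
  shows "A (\<lambda>x. f x - g x) = (\<lambda>y. A f y - A g y)"
proof -
  have "A (\<lambda>x. 1 * f x + (-1) * g x) = (\<lambda>y. 1 * A f y + (-1) * A g y)"
    using assms unfolding linear_on_def by blast
  then show ?thesis by simp
qed

locale bounded_symmetric = inner_product_functions H for H :: "'a inner_space" +
  fixes B :: "('a \<Rightarrow> complex) \<Rightarrow> 'a \<Rightarrow> complex" and C :: real
  assumes linear_B: "linear_operator H (vecs H) B"
    and C_nonneg: "0 \<le> C"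
    and bound_B: "\<And>f. f \<in> vecs H \<Longrightarrow> vnorm H (B f) \<le> C * vnorm H f"
    and symmetric_B: "\<And>f g. f \<in> vecs H \<Longrightarrow> g \<in> vecs H \<Longrightarrow> ip H (B f) g = ip H f (B g)"
begin

lemma B_mem: "f \<in> vecs H \<Longrightarrow> B f \<in> vecs H"
  using linear_B by (auto simp: linear_operator_def)

lemma B_diff:
  "f \<in> vecs H \<Longrightarrow> g \<in> vecs H \<Longrightarrow> B (\<lambda>x. f x - g x) = (\<lambda>y. B f y - B g y)"
  using linear_B by (intro linear_on_diff) (auto simp: linear_operator_def)

text \<open>An everywhere defined symmetric operator is maximal: its adjoint has no room for a larger
  domain, and its values are determined by symmetry.\<close>

lemma self_adjoint_graph_B: "self_adjoint_graph H (op_graph (vecs H) B)"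
proof -
  have dom: "Domain (op_graph (vecs H) B) = vecs H"
    by (auto simp: op_graph_def)
  have "\<exists>f\<in>vecs H. vnorm H (\<lambda>x. u x - f x) < e" if "u \<in> vecs H" "0 < e" for u and e :: real
    using that ip_lincomb[OF zero_mem zero_mem zero_mem, of 0 0]
    by (intro bexI[of _ u]) (auto simp: vnorm_def)
  then have dense: "dense_in H (vecs H)"
    by (auto simp: dense_in_def)
  have "v = B u" if u: "u \<in> vecs H" and v: "v \<in> vecs H"
    and eq: "\<And>f. f \<in> vecs H \<Longrightarrow> ip H (B f) u = ip H f v" for u v
  proof -
    \<comment> \<open>The vector \<open>v - B u\<close> is orthogonal to the whole space, in particular to itself.\<close>
    let ?w = "\<lambda>x. v x - B u x"
    have w: "?w \<in> vecs H" using u v by (intro diff_mem B_mem)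
    have "ip H ?w ?w = ip H ?w v - ip H ?w (B u)"
      using ip_diff_right[OF v B_mem[OF u] w] .
    also have "\<dots> = 0"
      using eq[OF w] symmetric_B[OF w u] by simp
    finally have "?w = (\<lambda>x. 0)"
      using w by (intro ip_self_zero) simp_all
    then show ?thesis by (metis (no_types) eq_iff_diff_eq_0 ext)
  qed
  then have "adjoint_graph H (op_graph (vecs H) B) = op_graph (vecs H) B"
    by (auto simp: adjoint_graph_def op_graph_def B_mem symmetric_B)
  with dom dense show ?thesis
    by (simp add: self_adjoint_graph_def)
qed

lemma self_adjoint_B: "self_adjoint H (vecs H) B"
  using linear_B self_adjoint_graph_B by (simp add: self_adjoint_def)

lemma B_close:
  assumes "u \<in> vecs H" "f \<in> vecs H" "vnorm H (\<lambda>x. u x - f x) < e / (C + 1)"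
  shows "vnorm H (\<lambda>x. B u x - B f x) < e"
proof -
  have "vnorm H (\<lambda>x. B u x - B f x) \<le> C * vnorm H (\<lambda>x. u x - f x)"
    using bound_B[OF diff_mem[OF assms(1,2)]] assms by (simp add: B_diff)
  also have "\<dots> \<le> (C + 1) * vnorm H (\<lambda>x. u x - f x)"
    using vnorm_nonneg[OF diff_mem[OF assms(1,2)]] by (intro mult_right_mono) auto
  also have "\<dots> < e"
    using assms(3) C_nonneg by (simp add: field_simps)
  finally show ?thesis .
qed

end

lemma bounded_operator_bound:
  assumes "bounded_operator H D A" "\<And>f. f \<in> D \<Longrightarrow> 0 \<le> vnorm H f"
  obtains C where "0 \<le> C" "\<And>f. f \<in> D \<Longrightarrow> vnorm H (A f) \<le> C * vnorm H f"
proof -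
  obtain C where C: "\<And>f. f \<in> D \<Longrightarrow> vnorm H (A f) \<le> C * vnorm H f"
    using assms(1) by (auto simp: bounded_operator_def)
  have "vnorm H (A f) \<le> \<bar>C\<bar> * vnorm H f" if "f \<in> D" for f
    using C[OF that] assms(2)[OF that] mult_right_mono[OF abs_ge_self[of C]] by fastforce
  with that[of "\<bar>C\<bar>"] show thesis by simp
qed

text \<open>An operator \<open>A\<close> on a dense subspace that is the restriction of an everywhere defined bounded
  symmetric operator \<open>B\<close>. The closure of its graph is the graph of \<open>B\<close>, which is
  self-adjoint; this is essential self-adjointness.\<close>

locale bounded_symmetric_restriction = bounded_symmetric H B C
  for H :: "'a inner_space" and B C +
  fixes D :: "('a \<Rightarrow> complex) set" and A :: "('a \<Rightarrow> complex) \<Rightarrow> 'a \<Rightarrow> complex"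
  assumes dense_D: "dense_in H D"
    and zero_D: "(\<lambda>x. 0) \<in> D"
    and lincomb_D: "\<And>f g a b. f \<in> D \<Longrightarrow> g \<in> D \<Longrightarrow> (\<lambda>x. a * f x + b * g x) \<in> D"
    and A_eq: "\<And>f. f \<in> D \<Longrightarrow> A f = B f"
begin

lemma D_mem: "f \<in> D \<Longrightarrow> f \<in> vecs H"
  using dense_D by (auto simp: dense_in_def)

lemma linear_A: "linear_operator H D A"
proof -
  have "B (\<lambda>x. a * f x + b * g x) = (\<lambda>y. a * B f y + b * B g y)" if "f \<in> D" "g \<in> D" for f g a b
    using linear_B that D_mem by (simp add: linear_operator_def linear_on_def)
  then show ?thesis
    using D_mem B_mem zero_D lincomb_D
    by (auto simp: linear_operator_def linear_on_def A_eq)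
qed

lemma bounded_A: "bounded_operator H D A"
  using linear_A bound_B D_mem A_eq by (auto simp: bounded_operator_def)

lemma op_norm_A: "op_norm H D A \<le> C"
  unfolding op_norm_def
proof (rule cSup_least)
  have "vnorm H (\<lambda>x. 0) = 0"
    using ip_lincomb[OF zero_mem zero_mem zero_mem, of 0 0] by (simp add: vnorm_def)
  then show "{vnorm H (A f) |f. f \<in> D \<and> vnorm H f \<le> 1} \<noteq> {}"
    using zero_D by auto
next
  fix r assume "r \<in> {vnorm H (A f) |f. f \<in> D \<and> vnorm H f \<le> 1}"
  then obtain f where f: "r = vnorm H (A f)" "f \<in> D" "vnorm H f \<le> 1" by blast
  have "r \<le> C * vnorm H f" using f bound_B[OF D_mem[OF f(2)]] A_eq by simp
  also have "\<dots> \<le> C" using f(3) C_nonneg by (simp add: mult_left_le)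
  finally show "r \<le> C" .
qed

lemma bounded_extension_B: "bounded_extension H D A B"
  using linear_B bound_B A_eq by (auto simp: bounded_extension_def bounded_operator_def)

text \<open>Near any \<open>u\<close> there is \<open>f \<in> D\<close>, where both extensions agree. Each moves little between \<open>f\<close> and
  \<open>u\<close>; the radius is chosen to fit both operator bounds.\<close>

lemma bounded_extension_unique:
  assumes ext: "bounded_extension H D A B'" and u: "u \<in> vecs H"
  shows "B' u = B u"
proof -
  have B': "bounded_operator H (vecs H) B'" "\<And>f. f \<in> D \<Longrightarrow> B' f = B f"
    using ext A_eq by (auto simp: bounded_extension_def)
  then have mem': "\<And>f. f \<in> vecs H \<Longrightarrow> B' f \<in> vecs H" and lin': "linear_on (vecs H) B'"
    by (auto simp: bounded_operator_def linear_operator_def)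
  obtain C' where C': "0 \<le> C'" "\<And>f. f \<in> vecs H \<Longrightarrow> vnorm H (B' f) \<le> C' * vnorm H f"
    using bounded_operator_bound[OF B'(1)] vnorm_nonneg by blast
  show ?thesis
  proof (rule eq_if_vnorm_diff_small)
    fix e :: real assume e: "0 < e"
    define d where "d = min (e / 2 / (C + 1)) (e / 2 / (C' + 1))"
    have "0 < d" using e C' C_nonneg by (simp add: d_def)
    then obtain f where f: "f \<in> D" "vnorm H (\<lambda>x. u x - f x) < d"
      using dense_D u unfolding dense_in_def by meson
    have fH: "f \<in> vecs H" using f D_mem by blast
    have "vnorm H (\<lambda>x. B u x - B f x) < e / 2"
      using f u fH by (intro B_close) (auto simp: d_def)
    moreover have "vnorm H (\<lambda>x. B' u x - B f x) < e / 2"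
    proof -
      have "vnorm H (\<lambda>x. B' u x - B f x) = vnorm H (B' (\<lambda>x. u x - f x))"
        using linear_on_diff[OF lin' u fH] B'(2)[OF f(1)] by simp
      also have "\<dots> \<le> C' * vnorm H (\<lambda>x. u x - f x)"
        using C'(2)[OF diff_mem[OF u fH]] .
      also have "\<dots> \<le> (C' + 1) * vnorm H (\<lambda>x. u x - f x)"
        using vnorm_nonneg[OF diff_mem[OF u fH]] by (intro mult_right_mono) auto
      also have "\<dots> < (C' + 1) * (e / 2 / (C' + 1))"
        using f(2) C' by (intro mult_strict_left_mono) (auto simp: d_def)
      also have "\<dots> = e / 2" using C'(1) by (simp add: divide_simps)
      finally show ?thesis .
    qed
    ultimately have "vnorm H (\<lambda>x. (B' u x - B f x) - (B u x - B f x)) < 2 * (e / 2)"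
      using u fH mem' B_mem by (intro vnorm_diff_less diff_mem)
    then show "vnorm H (\<lambda>x. B' u x - B u x) < e" by simp
  qed (use u mem' B_mem in auto)
qed

lemma closure_graph_A: "closure_graph H (op_graph D A) = op_graph (vecs H) B"
proof (intro set_eqI iffI; clarify)
  fix u v assume "(u, v) \<in> closure_graph H (op_graph D A)"
  then have u: "u \<in> vecs H" and v: "v \<in> vecs H" and
    approx: "\<And>e. 0 < e \<Longrightarrow> \<exists>f\<in>D. vnorm H (\<lambda>x. u x - f x) < e \<and> vnorm H (\<lambda>x. v x - B f x) < e"
    using A_eq by (fastforce simp: closure_graph_def op_graph_def)+
  have "v = B u"
  proof (rule eq_if_vnorm_diff_small)
    fix e :: real assume e: "0 < e"
    then have "0 < min (e / 2 / (C + 1)) (e / 2)" using C_nonneg by simp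
    then obtain f where f: "f \<in> D" "vnorm H (\<lambda>x. u x - f x) < e / 2 / (C + 1)"
      "vnorm H (\<lambda>x. v x - B f x) < e / 2"
      using approx by (meson min_less_iff_conj)
    have fH: "f \<in> vecs H" using f D_mem by blast
    have "vnorm H (\<lambda>x. (v x - B f x) - (B u x - B f x)) < 2 * (e / 2)"
      using u v fH f by (intro vnorm_diff_less diff_mem B_mem B_close)
    then show "vnorm H (\<lambda>x. v x - B u x) < e" by simp
  qed (use u v B_mem in auto)
  with u show "(u, v) \<in> op_graph (vecs H) B" by (auto simp: op_graph_def)
next
  fix u v assume "(u, v) \<in> op_graph (vecs H) B"
  then have u: "u \<in> vecs H" and v: "v = B u" by (auto simp: op_graph_def)
  have "\<exists>f\<in>D. vnorm H (\<lambda>x. u x - f x) < e \<and> vnorm H (\<lambda>x. v x - A f x) < e"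
    if e: "0 < e" for e
  proof -
    have "0 < min e (e / (C + 1))" using C_nonneg e by simp
    then obtain f where f: "f \<in> D" "vnorm H (\<lambda>x. u x - f x) < e"
      "vnorm H (\<lambda>x. u x - f x) < e / (C + 1)"
      using dense_D u unfolding dense_in_def by (meson min_less_iff_conj)
    then show ?thesis
      using u v D_mem B_close A_eq by (intro bexI[of _ f]) auto
  qed
  then show "(u, v) \<in> closure_graph H (op_graph D A)"
    using u v B_mem by (fastforce simp: closure_graph_def op_graph_def)
qed

lemma essentially_self_adjoint_A: "essentially_self_adjoint H D A"
  using linear_A self_adjoint_graph_B
  by (simp add: essentially_self_adjoint_def closure_graph_A)

end

text \<open>A linear injection transports the inner product back; the axioms are inherited by
  the source whenever its vectors form a subspace.\<close>

lemma inner_product_functions_pullback: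
  assumes K: "inner_product_functions K"
    and lin: "linear_on (vecs H) U" and into: "U ` vecs H \<subseteq> vecs K"
    and inj: "inj_on U (vecs H)"
    and ip: "\<And>f g. f \<in> vecs H \<Longrightarrow> g \<in> vecs H \<Longrightarrow> ip K (U f) (U g) = ip H f g"
  shows "inner_product_functions H"
proof -
  interpret K: inner_product_functions K by fact
  have lc: "(\<lambda>x. a * f x + b * g x) \<in> vecs H"
    "U (\<lambda>x. a * f x + b * g x) = (\<lambda>y. a * U f y + b * U g y)"
    if "f \<in> vecs H" "g \<in> vecs H" for f g a b
    using lin that by (auto simp: linear_on_def)
  have z: "(\<lambda>x. 0) \<in> vecs H" using lin by (simp add: linear_on_def)
  have U0: "U (\<lambda>x. 0) = (\<lambda>y. 0)" using lc(2)[OF z z, of 0 0] by simp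
  have mem: "U f \<in> vecs K" if "f \<in> vecs H" for f using into that by blast
  show ?thesis
  proof
    show "f = (\<lambda>x. 0)" if f: "f \<in> vecs H" and "Re (ip H f f) = 0" for f
    proof -
      have "U f = (\<lambda>y. 0)" using that ip[OF f f] mem by (intro K.ip_self_zero) auto
      then show ?thesis using inj_onD[OF inj, of f "\<lambda>x. 0"] f z U0 by simp
    qed
    show "ip H (\<lambda>x. a * f x + b * g x) h = a * ip H f h + b * ip H g h"
      if "f \<in> vecs H" "g \<in> vecs H" "h \<in> vecs H" for f g h a b
      using that by (simp add: lc mem K.ip_lincomb flip: ip)
    show "ip H g f = cnj (ip H f g)" if "f \<in> vecs H" "g \<in> vecs H" for f g
      using that mem K.ip_swap by (metis ip)
    show "0 \<le> Re (ip H f f)" if "f \<in> vecs H" for f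
      using that mem K.ip_self_nonneg by (metis ip)
  qed (use z lc in auto)
qed

section \<open>Square-summable functions and the Schur test\<close>

lemma vecs_l2_counting:
  "vecs (l2_counting S) = {f. (\<forall>x. x \<notin> S \<longrightarrow> f x = 0) \<and> (\<lambda>x. (cmod (f x))\<^sup>2) summable_on S}"
  by (simp add: l2_counting_def)

lemma ip_l2_counting: "ip (l2_counting S) f g = (\<Sum>\<^sub>\<infinity>x\<in>S. f x * cnj (g x))"
  by (simp add: l2_counting_def)

text \<open>This dominates products of square-summable functions.\<close>

lemma mult_le_sum_squares: "a * b \<le> a\<^sup>2 + b\<^sup>2" for a b :: real
proof -
  have "2 * (a * b) \<le> a\<^sup>2 + b\<^sup>2" using sum_squares_bound[of a b] by simp
  then show ?thesis using sum_power2_ge_zero[of a b] by linarith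
qed

lemma norm_lincomb_power2_le:
  fixes a b x y :: complex
  shows "(cmod (a * x + b * y))\<^sup>2 \<le> 2 * (cmod a)\<^sup>2 * (cmod x)\<^sup>2 + 2 * (cmod b)\<^sup>2 * (cmod y)\<^sup>2"
proof -
  have "(cmod (a * x + b * y))\<^sup>2 \<le> (cmod (a * x) + cmod (b * y))\<^sup>2"
    by (intro power_mono norm_triangle_ineq) simp
  also have "\<dots> \<le> 2 * (cmod (a * x))\<^sup>2 + 2 * (cmod (b * y))\<^sup>2"
    using sum_squares_bound[of "cmod (a * x)" "cmod (b * y)"] by (simp add: power2_sum)
  finally show ?thesis by (simp add: norm_mult power_mult_distrib mult.assoc)
qed

lemma summable_lincomb_power2:
  fixes f g :: "'a \<Rightarrow> complex"
  assumes "(\<lambda>x. (cmod (f x))\<^sup>2) summable_on S" "(\<lambda>x. (cmod (g x))\<^sup>2) summable_on S"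
  shows "(\<lambda>x. (cmod (a * f x + b * g x))\<^sup>2) summable_on S"
  using summable_on_add[OF summable_on_cmult_right[OF assms(1), of "2 * (cmod a)\<^sup>2"]
      summable_on_cmult_right[OF assms(2), of "2 * (cmod b)\<^sup>2"]]
  by (rule summable_on_comparison_test) (simp_all add: norm_lincomb_power2_le)

lemma summable_mult_cnj:
  fixes f g :: "'a \<Rightarrow> complex"
  assumes "(\<lambda>x. (cmod (f x))\<^sup>2) summable_on S" "(\<lambda>x. (cmod (g x))\<^sup>2) summable_on S"
  shows "(\<lambda>x. f x * cnj (g x)) summable_on S"
proof -
  have "(\<lambda>x. norm (f x * cnj (g x))) summable_on S"
    using summable_on_add[OF assms]
    by (rule summable_on_comparison_test) (simp_all add: norm_mult mult_le_sum_squares)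
  then show ?thesis by (rule abs_summable_summable)
qed

lemma ip_l2_counting_self:
  assumes "f \<in> vecs (l2_counting S)"
  shows "ip (l2_counting S) f f = of_real (\<Sum>\<^sub>\<infinity>x\<in>S. (cmod (f x))\<^sup>2)"
proof -
  have "ip (l2_counting S) f f = (\<Sum>\<^sub>\<infinity>x\<in>S. of_real ((cmod (f x))\<^sup>2))"
    unfolding ip_l2_counting by (intro infsum_cong) (metis complex_norm_square)
  also have "\<dots> = of_real (\<Sum>\<^sub>\<infinity>x\<in>S. (cmod (f x))\<^sup>2)"
    using assms by (intro infsumI has_sum_of_real has_sum_infsum) (simp add: vecs_l2_counting)
  finally show ?thesis .
qed

lemma vnorm_l2_counting:
  "f \<in> vecs (l2_counting S) \<Longrightarrow> vnorm (l2_counting S) f = sqrt (\<Sum>\<^sub>\<infinity>x\<in>S. (cmod (f x))\<^sup>2)"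
  by (simp add: vnorm_def ip_l2_counting_self)

interpretation l2_counting: inner_product_functions "l2_counting S" for S :: "'a set"
proof
  show "(\<lambda>x. 0) \<in> vecs (l2_counting S)"
    by (simp add: vecs_l2_counting)
  show "(\<lambda>x. a * f x + b * g x) \<in> vecs (l2_counting S)"
    if "f \<in> vecs (l2_counting S)" "g \<in> vecs (l2_counting S)" for f g a b
    using that by (simp add: vecs_l2_counting summable_lincomb_power2)
  show "ip (l2_counting S) (\<lambda>x. a * f x + b * g x) h
      = a * ip (l2_counting S) f h + b * ip (l2_counting S) g h"
    if "f \<in> vecs (l2_counting S)" "g \<in> vecs (l2_counting S)" "h \<in> vecs (l2_counting S)"
    for f g h a b
  proof -
    have s: "(\<lambda>x. f x * cnj (h x)) summable_on S" "(\<lambda>x. g x * cnj (h x)) summable_on S"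
      using that by (auto simp: vecs_l2_counting intro: summable_mult_cnj)
    have "ip (l2_counting S) (\<lambda>x. a * f x + b * g x) h
        = (\<Sum>\<^sub>\<infinity>x\<in>S. a * (f x * cnj (h x)) + b * (g x * cnj (h x)))"
      by (simp add: ip_l2_counting algebra_simps)
    also have "\<dots> = a * ip (l2_counting S) f h + b * ip (l2_counting S) g h"
      using s by (simp add: infsum_add infsum_cmult_right summable_on_cmult_right ip_l2_counting)
    finally show ?thesis .
  qed
  show "ip (l2_counting S) g f = cnj (ip (l2_counting S) f g)" for f g
    by (simp add: ip_l2_counting mult.commute flip: infsum_cnj)
  show "0 \<le> Re (ip (l2_counting S) f f)" if "f \<in> vecs (l2_counting S)" for f
    using that by (simp add: ip_l2_counting_self infsum_nonneg)
  show "f = (\<lambda>x. 0)" if f: "f \<in> vecs (l2_counting S)" and "Re (ip (l2_counting S) f f) = 0" for f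
  proof
    fix x
    show "f x = 0"
    proof (cases "x \<in> S")
      case True
      have "(cmod (f x))\<^sup>2 = 0"
        using that True
        by (intro nonneg_infsum_le_0D[where f = "\<lambda>x. (cmod (f x))\<^sup>2" and A = S])
          (auto simp: ip_l2_counting_self vecs_l2_counting)
      then show ?thesis by simp
    qed (use f in \<open>auto simp: vecs_l2_counting\<close>)
  qed
qed

lemma l2_counting_finite_approx:
  assumes g: "g \<in> vecs (l2_counting S)" and e: "0 < e"
  obtains F where "finite F" "F \<subseteq> S"
    "vnorm (l2_counting S) (\<lambda>x. g x - (if x \<in> F then g x else 0)) < e"
proof -
  let ?q = "\<lambda>x. (cmod (g x))\<^sup>2"
  have s: "?q summable_on S" using g by (simp add: vecs_l2_counting)
  have "0 < e\<^sup>2 / 2" using e by simp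
  then obtain F where F: "finite F" "F \<subseteq> S" "dist (sum ?q F) (infsum ?q S) \<le> e\<^sup>2 / 2"
    using infsum_finite_approximation[OF s] by blast
  have "(\<Sum>\<^sub>\<infinity>x\<in>S. (cmod (g x - (if x \<in> F then g x else 0)))\<^sup>2) = infsum ?q (S - F)"
    by (rule infsum_cong_neutral) auto
  also have "\<dots> = infsum ?q S - sum ?q F"
    using infsum_Diff[OF s summable_on_finite[OF F(1)] F(2)] F(1) by simp
  also have "\<dots> \<le> e\<^sup>2 / 2" using F(3) by (simp add: dist_real_def abs_le_iff del: le_divide_eq_numeral1)
  also have "\<dots> < e\<^sup>2" using e by simp
  finally have "(\<Sum>\<^sub>\<infinity>x\<in>S. (cmod (g x - (if x \<in> F then g x else 0)))\<^sup>2) < e\<^sup>2" .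
  moreover have "(\<lambda>x. g x - (if x \<in> F then g x else 0)) \<in> vecs (l2_counting S)"
  proof -
    have "(\<lambda>x. (cmod (g x - (if x \<in> F then g x else 0)))\<^sup>2) summable_on S"
      using s by (rule summable_on_comparison_test) auto
    then show ?thesis using g by (simp add: vecs_l2_counting)
  qed
  ultimately have "vnorm (l2_counting S) (\<lambda>x. g x - (if x \<in> F then g x else 0)) < e"
    using e by (simp add: vnorm_l2_counting real_less_lsqrt)
  with F that show thesis by blast
qed

text \<open>The hypotheses of the Schur test for a symmetric kernel, with the edges of a locally finite graph
  as its support. Finite rows make the operator a pointwise finite sum.\<close>

locale locally_finite_kernel =
  fixes S :: "'a set" and N :: "'a \<Rightarrow> 'a set" and K :: "'a \<Rightarrow> 'a \<Rightarrow> real" and C :: real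
  assumes finite_row: "\<And>x. finite (N x)"
    and row_subset: "\<And>x. N x \<subseteq> S"
    and row_sym: "\<And>x y. y \<in> N x \<Longrightarrow> x \<in> N y"
    and kernel_sym: "\<And>x y. y \<in> N x \<Longrightarrow> K x y = K y x"
    and row_bound_nonneg: "0 \<le> C"
    and row_bound: "\<And>x. x \<in> S \<Longrightarrow> (\<Sum>y\<in>N x. \<bar>K x y\<bar>) \<le> C"
begin

definition kernel_operator :: "('a \<Rightarrow> complex) \<Rightarrow> 'a \<Rightarrow> complex" where
  "kernel_operator f x = (\<Sum>y\<in>N x. of_real (K x y) * f y)"

lemma kernel_operator_outside: "x \<notin> S \<Longrightarrow> kernel_operator f x = 0"
  using row_sym row_subset by (fastforce simp: kernel_operator_def intro: sum.neutral)

lemma swap_edges: "bij_betw prod.swap (Sigma S N) (Sigma S N)"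
proof (rule bij_betwI[where g = prod.swap])
  show "prod.swap \<in> Sigma S N \<rightarrow> Sigma S N"
    using row_sym row_subset by fastforce
  then show "prod.swap \<in> Sigma S N \<rightarrow> Sigma S N" .
qed auto

lemma summable_row_weighted:
  assumes h: "h summable_on S" and nonneg: "\<And>x. x \<in> S \<Longrightarrow> 0 \<le> h x"
  shows "(\<lambda>(x, y). \<bar>K x y\<bar> * h x) summable_on Sigma S N"
proof (rule summable_on_SigmaI[where g = "\<lambda>x. (\<Sum>y\<in>N x. \<bar>K x y\<bar>) * h x"])
  show "((\<lambda>y. case (x, y) of (x, y) \<Rightarrow> \<bar>K x y\<bar> * h x) has_sum (\<Sum>y\<in>N x. \<bar>K x y\<bar>) * h x) (N x)" for x
    using has_sum_finite[OF finite_row, of "\<lambda>y. \<bar>K x y\<bar> * h x" x] by (simp add: sum_distrib_right)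
  show "(\<lambda>x. (\<Sum>y\<in>N x. \<bar>K x y\<bar>) * h x) summable_on S"
    using summable_on_cmult_right[OF h, of C]
    by (rule summable_on_comparison_test) (auto intro!: mult_right_mono mult_nonneg_nonneg sum_nonneg row_bound nonneg)
qed (use nonneg in auto)

text \<open>The symmetry of the kernel makes absolute column sums equal to absolute row sums, so that
  a weight may be attached to either end of an edge.\<close>

lemma summable_column_weighted:
  assumes h: "h summable_on S" and nonneg: "\<And>x. x \<in> S \<Longrightarrow> 0 \<le> h x"
  shows "(\<lambda>(x, y). \<bar>K x y\<bar> * h y) summable_on Sigma S N"
proof -
  have "(\<lambda>p. case prod.swap p of (x, y) \<Rightarrow> \<bar>K x y\<bar> * h x) summable_on Sigma S N"
    using summable_row_weighted[OF assms] summable_on_reindex_bij_betw[OF swap_edges] by blast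
  moreover have "(case prod.swap p of (x, y) \<Rightarrow> \<bar>K x y\<bar> * h x) = (case p of (x, y) \<Rightarrow> \<bar>K x y\<bar> * h y)"
    if "p \<in> Sigma S N" for p
    using that by (auto dest: kernel_sym)
  ultimately show ?thesis
    by (simp cong: summable_on_cong)
qed

lemma column_weighted_le:
  assumes h: "h summable_on S" and nonneg: "\<And>x. x \<in> S \<Longrightarrow> 0 \<le> h x"
  shows "(\<lambda>x. \<Sum>y\<in>N x. \<bar>K x y\<bar> * h y) summable_on S"
    and "(\<Sum>\<^sub>\<infinity>x\<in>S. \<Sum>y\<in>N x. \<bar>K x y\<bar> * h y) \<le> C * infsum h S"
proof -
  note sum = summable_column_weighted[OF assms]
  have row: "(\<Sum>\<^sub>\<infinity>y\<in>N x. \<bar>K x y\<bar> * h y) = (\<Sum>y\<in>N x. \<bar>K x y\<bar> * h y)" for h x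
    using finite_row by simp
  show "(\<lambda>x. \<Sum>y\<in>N x. \<bar>K x y\<bar> * h y) summable_on S"
    using summable_on_Sigma_banach[OF sum] by (simp add: row)
  have "(\<Sum>\<^sub>\<infinity>x\<in>S. \<Sum>y\<in>N x. \<bar>K x y\<bar> * h y) = (\<Sum>\<^sub>\<infinity>(x, y)\<in>Sigma S N. \<bar>K x y\<bar> * h y)"
    using infsum_Sigma'_banach[OF sum] by (simp add: row)
  also have "\<dots> = (\<Sum>\<^sub>\<infinity>p\<in>Sigma S N. case prod.swap p of (x, y) \<Rightarrow> \<bar>K x y\<bar> * h y)"
    by (rule infsum_reindex_bij_betw[OF swap_edges, symmetric])
  also have "\<dots> = (\<Sum>\<^sub>\<infinity>(x, y)\<in>Sigma S N. \<bar>K x y\<bar> * h x)"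
    by (rule infsum_cong) (auto dest: kernel_sym)
  also have "\<dots> = (\<Sum>\<^sub>\<infinity>x\<in>S. \<Sum>\<^sub>\<infinity>y\<in>N x. \<bar>K x y\<bar> * h x)"
    using infsum_Sigma'_banach[OF summable_row_weighted[OF assms]] by simp
  also have "\<dots> = (\<Sum>\<^sub>\<infinity>x\<in>S. (\<Sum>y\<in>N x. \<bar>K x y\<bar>) * h x)"
    by (simp add: finite_row sum_distrib_right)
  also have "\<dots> \<le> (\<Sum>\<^sub>\<infinity>x\<in>S. C * h x)"
  proof (rule infsum_mono)
    show "(\<lambda>x. C * h x) summable_on S" using h by (rule summable_on_cmult_right)
    then show "(\<lambda>x. (\<Sum>y\<in>N x. \<bar>K x y\<bar>) * h x) summable_on S"
      by (rule summable_on_comparison_test) (auto intro!: mult_right_mono mult_nonneg_nonneg sum_nonneg row_bound nonneg)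
  qed (auto intro!: mult_right_mono row_bound nonneg)
  also have "\<dots> = C * infsum h S" using h by (simp add: infsum_cmult_right)
  finally show "(\<Sum>\<^sub>\<infinity>x\<in>S. \<Sum>y\<in>N x. \<bar>K x y\<bar> * h y) \<le> C * infsum h S" .
qed

text \<open>The Cauchy--Schwarz inequality for the weights \<open>\<bar>K x y\<bar>\<close> on a single row.\<close>

lemma kernel_operator_pointwise:
  assumes x: "x \<in> S"
  shows "(cmod (kernel_operator f x))\<^sup>2 \<le> C * (\<Sum>y\<in>N x. \<bar>K x y\<bar> * (cmod (f y))\<^sup>2)"
proof -
  have "cmod (kernel_operator f x) \<le> (\<Sum>y\<in>N x. \<bar>K x y\<bar> * cmod (f y))"
    unfolding kernel_operator_def by (rule sum_norm_le) (simp add: norm_mult)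
  also have "\<dots> = (\<Sum>y\<in>N x. sqrt \<bar>K x y\<bar> * (sqrt \<bar>K x y\<bar> * cmod (f y)))"
    by (simp flip: mult.assoc)
  finally have "(cmod (kernel_operator f x))\<^sup>2 \<le> (\<Sum>y\<in>N x. sqrt \<bar>K x y\<bar> * (sqrt \<bar>K x y\<bar> * cmod (f y)))\<^sup>2"
    by (rule power_mono) simp
  also have "\<dots> \<le> (\<Sum>y\<in>N x. (sqrt \<bar>K x y\<bar>)\<^sup>2) * (\<Sum>y\<in>N x. (sqrt \<bar>K x y\<bar> * cmod (f y))\<^sup>2)"
    by (rule Cauchy_Schwarz_ineq_sum)
  also have "\<dots> = (\<Sum>y\<in>N x. \<bar>K x y\<bar>) * (\<Sum>y\<in>N x. \<bar>K x y\<bar> * (cmod (f y))\<^sup>2)"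
    by (simp add: power_mult_distrib)
  also have "\<dots> \<le> C * (\<Sum>y\<in>N x. \<bar>K x y\<bar> * (cmod (f y))\<^sup>2)"
    using row_bound[OF x] by (intro mult_right_mono sum_nonneg) auto
  finally show ?thesis .
qed

lemma kernel_operator_l2:
  assumes f: "f \<in> vecs (l2_counting S)"
  shows "kernel_operator f \<in> vecs (l2_counting S)"
    and "vnorm (l2_counting S) (kernel_operator f) \<le> C * vnorm (l2_counting S) f"
proof -
  let ?h = "\<lambda>x. (cmod (f x))\<^sup>2"
  have h: "?h summable_on S" using f by (simp add: vecs_l2_counting)
  have dom: "(\<lambda>x. C * (\<Sum>y\<in>N x. \<bar>K x y\<bar> * ?h y)) summable_on S"
    using column_weighted_le(1)[OF h] by (intro summable_on_cmult_right) simp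
  then have s: "(\<lambda>x. (cmod (kernel_operator f x))\<^sup>2) summable_on S"
    by (rule summable_on_comparison_test) (auto intro: kernel_operator_pointwise)
  then show mem: "kernel_operator f \<in> vecs (l2_counting S)"
    by (simp add: vecs_l2_counting kernel_operator_outside)
  have "(\<Sum>\<^sub>\<infinity>x\<in>S. (cmod (kernel_operator f x))\<^sup>2) \<le> (\<Sum>\<^sub>\<infinity>x\<in>S. C * (\<Sum>y\<in>N x. \<bar>K x y\<bar> * ?h y))"
    using s dom by (rule infsum_mono) (rule kernel_operator_pointwise)
  also have "\<dots> = C * (\<Sum>\<^sub>\<infinity>x\<in>S. \<Sum>y\<in>N x. \<bar>K x y\<bar> * ?h y)"
    using column_weighted_le(1)[OF h] by (intro infsum_cmult_right) simp
  also have "\<dots> \<le> C * (C * infsum ?h S)"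
    using column_weighted_le(2)[OF h] row_bound_nonneg by (intro mult_left_mono) auto
  finally have "(\<Sum>\<^sub>\<infinity>x\<in>S. (cmod (kernel_operator f x))\<^sup>2) \<le> C\<^sup>2 * infsum ?h S"
    by (simp add: power2_eq_square mult.assoc)
  then show "vnorm (l2_counting S) (kernel_operator f) \<le> C * vnorm (l2_counting S) f"
    using row_bound_nonneg real_sqrt_le_mono by (fastforce simp: vnorm_l2_counting[OF mem] vnorm_l2_counting[OF f] real_sqrt_mult)
qed

lemma kernel_operator_symmetric:
  assumes f: "f \<in> vecs (l2_counting S)" and g: "g \<in> vecs (l2_counting S)"
  shows "ip (l2_counting S) (kernel_operator f) g = ip (l2_counting S) f (kernel_operator g)"
proof -
  let ?F = "\<lambda>x y. of_real (K x y) * f y * cnj (g x)"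
  have "(\<lambda>(x, y). \<bar>K x y\<bar> * (cmod (f y))\<^sup>2) summable_on Sigma S N"
    using f by (intro summable_column_weighted) (auto simp: vecs_l2_counting)
  moreover have "(\<lambda>(x, y). \<bar>K x y\<bar> * (cmod (g x))\<^sup>2) summable_on Sigma S N"
    using g by (intro summable_row_weighted) (auto simp: vecs_l2_counting)
  ultimately have "(\<lambda>p. (case p of (x, y) \<Rightarrow> \<bar>K x y\<bar> * (cmod (f y))\<^sup>2)
      + (case p of (x, y) \<Rightarrow> \<bar>K x y\<bar> * (cmod (g x))\<^sup>2)) summable_on Sigma S N"
    by (rule summable_on_add)
  then have "(\<lambda>p. norm (case p of (x, y) \<Rightarrow> ?F x y)) summable_on Sigma S N"
  proof (rule summable_on_comparison_test)
    fix p assume "p \<in> Sigma S N"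
    obtain x y where p: "p = (x, y)" by fastforce
    show "norm (case p of (x, y) \<Rightarrow> ?F x y) \<le> (case p of (x, y) \<Rightarrow> \<bar>K x y\<bar> * (cmod (f y))\<^sup>2)
      + (case p of (x, y) \<Rightarrow> \<bar>K x y\<bar> * (cmod (g x))\<^sup>2)"
      using mult_left_mono[OF mult_le_sum_squares[of "cmod (f y)" "cmod (g x)"], of "\<bar>K x y\<bar>"]
      by (simp add: p norm_mult algebra_simps)
  qed simp
  then have sum: "(\<lambda>(x, y). ?F x y) summable_on Sigma S N"
    by (rule abs_summable_summable)
  then have sum': "(\<lambda>p. case prod.swap p of (x, y) \<Rightarrow> ?F x y) summable_on Sigma S N"
    by (simp only: summable_on_reindex_bij_betw[OF swap_edges])
  have swapped: "(case prod.swap p of (x, y) \<Rightarrow> ?F x y)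
      = (case p of (x, y) \<Rightarrow> f x * cnj (of_real (K x y) * g y))" if "p \<in> Sigma S N" for p
    using that by (auto dest: kernel_sym)
  have "ip (l2_counting S) (kernel_operator f) g = (\<Sum>\<^sub>\<infinity>x\<in>S. \<Sum>\<^sub>\<infinity>y\<in>N x. ?F x y)"
    by (simp add: ip_l2_counting kernel_operator_def finite_row sum_distrib_right)
  also have "\<dots> = (\<Sum>\<^sub>\<infinity>(x, y)\<in>Sigma S N. ?F x y)"
    by (rule infsum_Sigma'_banach[OF sum])
  also have "\<dots> = (\<Sum>\<^sub>\<infinity>p\<in>Sigma S N. case prod.swap p of (x, y) \<Rightarrow> ?F x y)"
    by (rule infsum_reindex_bij_betw[OF swap_edges, symmetric])
  also have "\<dots> = (\<Sum>\<^sub>\<infinity>(x, y)\<in>Sigma S N. f x * cnj (of_real (K x y) * g y))"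
    by (rule infsum_cong) (rule swapped)
  also have "\<dots> = (\<Sum>\<^sub>\<infinity>x\<in>S. \<Sum>\<^sub>\<infinity>y\<in>N x. f x * cnj (of_real (K x y) * g y))"
    using sum' by (intro infsum_Sigma'_banach[symmetric]) (simp only: swapped cong: summable_on_cong)
  also have "\<dots> = ip (l2_counting S) f (kernel_operator g)"
    by (simp add: ip_l2_counting kernel_operator_def finite_row sum_distrib_left)
  finally show ?thesis .
qed

lemma kernel_operator_lincomb:
  "kernel_operator (\<lambda>x. a * f x + b * g x) = (\<lambda>x. a * kernel_operator f x + b * kernel_operator g x)"
  by (rule ext) (simp add: kernel_operator_def sum_distrib_left algebra_simps sum.distrib)

text \<open>The Schur test, together with the symmetry of the kernel, places kernel operators in the scope
  of the abstract theory.\<close>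

sublocale bounded_symmetric "l2_counting S" kernel_operator C
proof
  show "linear_operator (l2_counting S) (vecs (l2_counting S)) kernel_operator"
    using kernel_operator_l2(1) l2_counting.zero_mem l2_counting.lincomb_mem
    by (auto simp: linear_operator_def linear_on_def kernel_operator_lincomb)
qed (use row_bound_nonneg kernel_operator_l2 kernel_operator_symmetric in auto)

end

section \<open>Orientations and signs of vertex orderings\<close>

lemma sign_permutes_compose:
  assumes "finite A" "\<pi> permutes A" "\<rho> permutes A"
  shows "sign (\<pi> \<circ> \<rho>) = sign \<pi> * sign \<rho>"
  using assms by (intro sign_compose permutes_imp_permutation[of A])

lemma evenperm_permutes_compose:
  assumes "finite A" "\<pi> permutes A" "\<rho> permutes A"
  shows "evenperm (\<pi> \<circ> \<rho>) \<longleftrightarrow> (evenperm \<pi> \<longleftrightarrow> evenperm \<rho>)"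
  using assms by (intro evenperm_comp permutes_imp_permutation[of A])

lemma exists_permute_list:
  assumes "distinct xs" "distinct ys" "set xs = set ys"
  obtains \<pi> where "\<pi> permutes {..<length xs}" "ys = permute_list \<pi> xs"
  using assms set_eq_iff_mset_eq_distinct mset_eq_permutation by metis

lemma permute_list_inj:
  assumes "distinct xs" and \<pi>: "\<pi> permutes {..<length xs}" and \<rho>: "\<rho> permutes {..<length xs}"
    and eq: "permute_list \<pi> xs = permute_list \<rho> xs"
  shows "\<pi> = \<rho>"
proof
  fix i
  show "\<pi> i = \<rho> i"
  proof (cases "i < length xs")
    case True
    then have "xs ! \<pi> i = xs ! \<rho> i"
      using eq permute_list_nth[OF \<pi>] permute_list_nth[OF \<rho>] by metis
    moreover have "\<pi> i < length xs" "\<rho> i < length xs"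
      using True permutes_in_image[OF \<pi>] permutes_in_image[OF \<rho>] by auto
    ultimately show ?thesis using assms(1) nth_eq_iff_index_eq by blast
  next
    case False
    then show ?thesis using \<pi> \<rho> by (simp add: permutes_not_in)
  qed
qed

lemma mem_oriented_iff:
  "ys \<in> oriented xs \<longleftrightarrow> (\<exists>\<pi>. \<pi> permutes {..<length xs} \<and> evenperm \<pi> \<and> ys = permute_list \<pi> xs)"
  by (auto simp: oriented_def even_permutation_rel_def)

lemma self_mem_oriented: "xs \<in> oriented xs"
  unfolding mem_oriented_iff by (intro exI[of _ id]) (simp add: permutes_id)

lemma underlying_oriented: "underlying (oriented xs) = set xs"
proof -
  have "set ys = set xs" if "ys \<in> oriented xs" for ys
    using that by (auto simp: mem_oriented_iff)
  then show ?thesis using self_mem_oriented[of xs] unfolding underlying_def by blast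
qed

lemma representative_mem: "representative (oriented xs) \<in> oriented xs"
  unfolding representative_def using self_mem_oriented[of xs] by (rule someI)

lemma oriented_permute_even:
  assumes \<pi>: "\<pi> permutes {..<length xs}" and "evenperm \<pi>"
  shows "oriented (permute_list \<pi> xs) = oriented xs"
proof -
  have sub: "oriented (permute_list \<rho> zs) \<subseteq> oriented zs"
    if "\<rho> permutes {..<length zs}" "evenperm \<rho>" for \<rho> and zs :: "'a list"
  proof
    fix ys assume "ys \<in> oriented (permute_list \<rho> zs)"
    then obtain \<phi> where "\<phi> permutes {..<length zs}" "evenperm \<phi>"
      "ys = permute_list \<phi> (permute_list \<rho> zs)"
      by (auto simp: mem_oriented_iff)
    moreover from this have "evenperm (\<rho> \<circ> \<phi>)"
      using that evenperm_permutes_compose[of "{..<length zs}" \<rho> \<phi>] by simp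
    ultimately show "ys \<in> oriented zs"
      using that by (auto simp: mem_oriented_iff permute_list_compose
          intro!: exI[of _ "\<rho> \<circ> \<phi>"] permutes_compose)
  qed
  have inv: "inv \<pi> permutes {..<length xs}" "evenperm (inv \<pi>)"
    using assms permutes_imp_permutation[of "{..<length xs}"] by (auto simp: permutes_inv evenperm_inv)
  have "permute_list (inv \<pi>) (permute_list \<pi> xs) = xs"
    using permute_list_compose[OF inv(1), of \<pi>] permutes_inv_o(1)[OF \<pi>] by simp
  then show ?thesis
    using sub[OF assms] sub[of "inv \<pi>" "permute_list \<pi> xs"] inv by auto
qed

text \<open>A list of distinct vertices determines the permutation that rearranges it, so an odd
  rearrangement cannot also be an even one.\<close>

lemma oriented_permute_odd:
  assumes "distinct xs" and \<pi>: "\<pi> permutes {..<length xs}" and odd: "\<not> evenperm \<pi>"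
  shows "oriented (permute_list \<pi> xs) \<noteq> oriented xs"
proof
  assume "oriented (permute_list \<pi> xs) = oriented xs"
  then obtain \<rho> where \<rho>: "\<rho> permutes {..<length xs}" "evenperm \<rho>"
    "permute_list \<pi> xs = permute_list \<rho> xs"
    using self_mem_oriented[of "permute_list \<pi> xs"] by (auto simp: mem_oriented_iff)
  then show False using permute_list_inj[OF assms(1) \<pi> \<rho>(1)] odd by simp
qed

text \<open>Moving the \<open>i\<close>-th entry to the front takes \<open>i\<close> adjacent transpositions; this is where the
  alternating signs of the coboundary come from.\<close>

lemma move_to_front:
  "\<exists>\<pi>. \<pi> permutes {..<length (us @ x # vs)} \<and> sign \<pi> = (-1) ^ length us \<and>
    x # us @ vs = permute_list \<pi> (us @ x # vs)"
proof (induction us arbitrary: vs rule: rev_induct)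
  case Nil
  show ?case by (intro exI[of _ id] conjI permutes_id) simp_all
next
  case (snoc u us)
  let ?L = "(us @ [u]) @ x # vs" and ?\<tau> = "Transposition.transpose (length us) (Suc (length us))"
  have \<tau>: "?\<tau> permutes {..<length ?L}"
    by (intro permutes_swap_id) auto
  have swap: "permute_list ?\<tau> ?L = us @ x # u # vs"
  proof (rule nth_equalityI)
    fix i assume "i < length (permute_list ?\<tau> ?L)"
    then have "permute_list ?\<tau> ?L ! i = ?L ! ?\<tau> i"
      using permute_list_nth[OF \<tau>] by simp
    also have "\<dots> = (us @ x # u # vs) ! i"
    proof -
      consider "i < length us" | "i = length us" | "i = Suc (length us)"
        | j where "i = Suc (Suc (length us)) + j"
        by (metis less_iff_Suc_add not_less_eq add_Suc linorder_neqE_nat)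
      then show ?thesis by cases (simp_all add: Transposition.transpose_def nth_append)
    qed
    finally show "permute_list ?\<tau> ?L ! i = (us @ x # u # vs) ! i" .
  qed simp
  obtain \<pi> where \<pi>: "\<pi> permutes {..<length ?L}" "sign \<pi> = (-1) ^ length us"
    "x # us @ u # vs = permute_list \<pi> (us @ x # u # vs)"
    using snoc.IH[of "u # vs"] by auto
  have "x # (us @ [u]) @ vs = permute_list (?\<tau> \<circ> \<pi>) ?L"
    using \<pi>(3) permute_list_compose[OF \<pi>(1), of ?\<tau>] swap by simp
  moreover have "sign (?\<tau> \<circ> \<pi>) = (-1) ^ length (us @ [u])"
    using sign_permutes_compose[OF _ \<tau> \<pi>(1)] \<pi>(2) by (simp add: sign_swap_id)
  ultimately show ?case
    using permutes_compose[OF \<pi>(1) \<tau>] by blast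
qed

text \<open>Rearranging a facet while keeping the opposite vertex in front changes the orientation of the
  simplex by the same sign; this makes incidence numbers independent of the ordering of the
  facet.\<close>

lemma permute_list_Cons_lift:
  assumes \<pi>: "\<pi> permutes {..<length zs}"
  obtains \<rho> where "\<rho> permutes {..<length (x # zs)}" "sign \<rho> = sign \<pi>"
    "permute_list \<rho> (x # zs) = x # permute_list \<pi> zs"
proof -
  let ?\<rho> = "map_permutation {..<length zs} Suc \<pi>"
  have "?\<rho> permutes Suc ` {..<length zs}"
    using \<pi> by (intro map_permutation_permutes) (auto simp: bij_betw_def)
  then have perm: "?\<rho> permutes {..<length (x # zs)}"
    by (rule permutes_subset) auto
  have "permute_list ?\<rho> (x # zs) = x # permute_list \<pi> zs"
  proof (rule nth_equalityI)
    fix i assume i: "i < length (permute_list ?\<rho> (x # zs))"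
    have "?\<rho> 0 = 0"
      by (simp add: map_permutation_def restrict_id_def)
    moreover have "?\<rho> (Suc j) = Suc (\<pi> j)" if "j < length zs" for j
      using that by (intro map_permutation_apply) auto
    ultimately show "permute_list ?\<rho> (x # zs) ! i = (x # permute_list \<pi> zs) ! i"
      using i permute_list_nth[OF perm] permute_list_nth[OF \<pi>] by (cases i) auto
  qed simp
  moreover have "sign ?\<rho> = sign \<pi>"
    using \<pi> by (intro sign_map_permutation) auto
  ultimately show thesis using that perm by blast
qed

section \<open>Simplices and their facets\<close>

lemma oriented_simplices_eq: "oriented_simplices V m k = oriented ` ordered_simplices V m k"
  by (auto simp: oriented_simplices_def quotient_def oriented_def)

lemma unoriented_simplices_eq: "unoriented_simplices V m k = set ` ordered_simplices V m k"
  by (simp add: unoriented_simplices_def oriented_simplices_eq image_image underlying_oriented)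

lemma ordered_simplices_cong:
  assumes "xs \<in> ordered_simplices V m k" "distinct ys" "set ys = set xs"
  shows "ys \<in> ordered_simplices V m k"
  using assms distinct_card[of xs] distinct_card[of ys] by (auto simp: ordered_simplices_def)

lemma ordered_simplices_permute:
  "xs \<in> ordered_simplices V m k \<Longrightarrow> \<pi> permutes {..<length xs} \<Longrightarrow>
    permute_list \<pi> xs \<in> ordered_simplices V m k"
  by (rule ordered_simplices_cong) (auto simp: ordered_simplices_def)

lemma ordered_simplices_oriented:
  "xs \<in> ordered_simplices V m k \<Longrightarrow> ys \<in> oriented xs \<Longrightarrow> ys \<in> ordered_simplices V m k"
  by (auto simp: mem_oriented_iff ordered_simplices_permute)

lemma oriented_eq_if_mem: "ys \<in> oriented xs \<Longrightarrow> oriented ys = oriented xs"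
  by (auto simp: mem_oriented_iff oriented_permute_even)

lemma set_eq_if_mem_oriented: "ys \<in> oriented xs \<Longrightarrow> set ys = set xs"
  by (auto simp: mem_oriented_iff)

lemma ordered_simplicesD:
  assumes "xs \<in> ordered_simplices V m k"
  shows "length xs = Suc k" "distinct xs" "set xs \<subseteq> V"
  using assms by (auto simp: ordered_simplices_def)

lemma unoriented_simplices_finite:
  "\<sigma> \<in> unoriented_simplices V m k \<Longrightarrow> finite \<sigma> \<and> card \<sigma> = Suc k"
  by (auto simp: unoriented_simplices_eq ordered_simplices_def distinct_card)

lemma mem_unoriented_if_ordered:
  "xs \<in> ordered_simplices V m k \<Longrightarrow> set xs \<in> unoriented_simplices V m k"
  by (simp add: unoriented_simplices_eq)

lemma mem_oriented_simplices_if_ordered: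
  "xs \<in> ordered_simplices V m k \<Longrightarrow> oriented xs \<in> oriented_simplices V m k"
  by (simp add: oriented_simplices_eq)

definition cofacets :: "'v set \<Rightarrow> (nat \<Rightarrow> 'v list \<Rightarrow> real) \<Rightarrow> nat \<Rightarrow> 'v set \<Rightarrow> 'v set set" where
  "cofacets V m n \<tau> = {\<sigma> \<in> unoriented_simplices V m n. \<tau> \<in> facets \<sigma>}"

lemma finite_facets: "finite \<sigma> \<Longrightarrow> finite (facets \<sigma>)"
  by (simp add: facets_def)

lemma inj_on_remove: "inj_on (\<lambda>x. \<sigma> - {x}) \<sigma>"
  by (auto simp: inj_on_def)

text \<open>If the vertex of \<open>\<sigma>\<close> outside a common facet lay in \<open>\<sigma>'\<close>, then \<open>\<sigma> \<subseteq> \<sigma>'\<close>, and the two sets would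
  coincide by their size. So adjacent simplices are joined by a single path through a facet.\<close>

lemma common_facet_eq_Int:
  assumes "finite \<sigma>" "finite \<sigma>'" "card \<sigma> = card \<sigma>'" "\<sigma> \<noteq> \<sigma>'" "\<tau> \<in> facets \<sigma>" "\<tau> \<in> facets \<sigma>'"
  shows "\<tau> = \<sigma> \<inter> \<sigma>'"
proof -
  obtain x where x: "x \<in> \<sigma>" "\<tau> = \<sigma> - {x}" using assms by (auto simp: facets_def)
  have sub: "\<tau> \<subseteq> \<sigma>'" using assms by (auto simp: facets_def)
  have "x \<notin> \<sigma>'"
  proof
    assume "x \<in> \<sigma>'"
    then have "\<sigma> \<subseteq> \<sigma>'" using sub x by auto
    then show False using assms card_subset_eq by metis
  qed
  with sub x show ?thesis by auto
qed

locale oriented_complex = weighted_complex V m n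
  for V :: "'v set" and m :: "nat \<Rightarrow> 'v list \<Rightarrow> real" and n :: nat +
  fixes \<omega> :: "'v set \<Rightarrow> 'v list set"
  assumes reference: "reference_orientation V m n \<omega>"
    and finite_neighbours: "\<And>x. x \<in> V \<Longrightarrow> finite (neighbours V m x)"
begin

lemma Suc_dim: "Suc (n - 1) = n"
  using dim_pos by simp

lemma adjacent_sym: "adjacent V m x y \<longleftrightarrow> adjacent V m y x"
  using edge_weight_sym by (auto simp: adjacent_def)

lemma not_adjacent_self: "\<not> adjacent V m x x"
  using edge_weight_diag by (auto simp: adjacent_def)

lemma Cons_simplex_iff:
  assumes "ys \<in> ordered_simplices V m (n - 1)"
  shows "x # ys \<in> ordered_simplices V m n \<longleftrightarrow> x \<in> (\<Inter>y\<in>set ys. neighbours V m y)"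
proof
  assume "x # ys \<in> ordered_simplices V m n"
  then show "x \<in> (\<Inter>y\<in>set ys. neighbours V m y)"
    by (auto simp: ordered_simplices_def neighbours_def)
next
  assume x: "x \<in> (\<Inter>y\<in>set ys. neighbours V m y)"
  obtain y where "y \<in> set ys"
    using ordered_simplicesD(1)[OF assms] by (cases ys) auto
  then have "x \<in> V" using x by (auto simp: neighbours_def adjacent_def)
  moreover have "x \<notin> set ys" using x not_adjacent_self by (auto simp: neighbours_def)
  ultimately show "x # ys \<in> ordered_simplices V m n"
    using assms x Suc_dim adjacent_sym by (auto simp: ordered_simplices_def neighbours_def)
qed

lemma facet_simplex:
  assumes "\<sigma> \<in> unoriented_simplices V m n" "\<tau> \<in> facets \<sigma>"
  obtains x ys where "ys \<in> ordered_simplices V m (n - 1)" "x # ys \<in> ordered_simplices V m n"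
    "\<tau> = set ys" "\<sigma> = insert x (set ys)" "x \<notin> set ys"
proof -
  obtain xs where xs: "xs \<in> ordered_simplices V m n" "\<sigma> = set xs"
    using assms by (auto simp: unoriented_simplices_eq)
  obtain x where x: "x \<in> set xs" "\<tau> = set xs - {x}" using assms xs by (auto simp: facets_def)
  obtain ys where ys: "set ys = \<tau>" "distinct ys"
    using x by (metis finite_distinct_list finite_Diff List.finite_set)
  have "x # ys \<in> ordered_simplices V m n"
    using x ys by (intro ordered_simplices_cong[OF xs(1)]) auto
  moreover from this have "ys \<in> ordered_simplices V m (n - 1)"
    using Suc_dim by (auto simp: ordered_simplices_def)
  ultimately show thesis using that x ys xs by auto
qed

lemma facet_unoriented:
  "\<sigma> \<in> unoriented_simplices V m n \<Longrightarrow> \<tau> \<in> facets \<sigma> \<Longrightarrow> \<tau> \<in> unoriented_simplices V m (n - 1)"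
  by (rule facet_simplex) (auto intro: mem_unoriented_if_ordered)

lemma finite_link:
  assumes "ys \<in> ordered_simplices V m k"
  shows "finite (\<Inter>y\<in>set ys. neighbours V m y)"
proof -
  obtain y where "y \<in> set ys"
    using ordered_simplicesD(1)[OF assms] by (cases ys) auto
  moreover have "set ys \<subseteq> V" by (rule ordered_simplicesD(3)[OF assms])
  ultimately show ?thesis using finite_neighbours by blast
qed

text \<open>Through this bijection the sum over vertices in the codifferential becomes a sum over unoriented simplices.\<close>

lemma bij_betw_link_cofacets:
  assumes ys: "ys \<in> ordered_simplices V m (n - 1)"
  shows "bij_betw (\<lambda>x. insert x (set ys)) (\<Inter>y\<in>set ys. neighbours V m y) (cofacets V m n (set ys))"
    (is "bij_betw ?f ?L ?S")
proof (rule bij_betw_imageI)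
  have notin: "x \<notin> set ys" if "x \<in> ?L" for x
    using Cons_simplex_iff[OF ys, of x] that ordered_simplicesD(2)[of "x # ys" V m n] by auto
  show "inj_on ?f ?L"
    using notin by (auto simp: inj_on_def)
  show "?f ` ?L = ?S"
  proof
    show "?f ` ?L \<subseteq> ?S"
    proof
      fix \<sigma> assume "\<sigma> \<in> ?f ` ?L"
      then obtain x where x: "x \<in> ?L" "\<sigma> = insert x (set ys)" by blast
      then have "x # ys \<in> ordered_simplices V m n" using Cons_simplex_iff[OF ys] by blast
      then have "\<sigma> \<in> unoriented_simplices V m n"
        using mem_unoriented_if_ordered x by fastforce
      moreover have "set ys \<in> facets \<sigma>"
        using x notin[OF x(1)] by (auto simp: facets_def)
      ultimately show "\<sigma> \<in> ?S" by (simp add: cofacets_def)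
    qed
    show "?S \<subseteq> ?f ` ?L"
    proof
      fix \<sigma> assume \<sigma>: "\<sigma> \<in> ?S"
      then have "\<sigma> \<in> unoriented_simplices V m n" "set ys \<in> facets \<sigma>" by (simp_all add: cofacets_def)
      then obtain x zs where z: "x # zs \<in> ordered_simplices V m n" "set ys = set zs"
        "\<sigma> = insert x (set zs)" "x \<notin> set zs"
        by (rule facet_simplex)
      have "x # ys \<in> ordered_simplices V m n"
        using z ordered_simplicesD(2)[OF ys] by (intro ordered_simplices_cong[OF z(1)]) auto
      then show "\<sigma> \<in> ?f ` ?L" using Cons_simplex_iff[OF ys] z by auto
    qed
  qed
qed

lemma finite_cofacets: "\<tau> \<in> unoriented_simplices V m (n - 1) \<Longrightarrow> finite (cofacets V m n \<tau>)"
  unfolding unoriented_simplices_eq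
  using bij_betw_link_cofacets finite_link bij_betw_finite by blast

lemma simplex_weight_pos:
  assumes "k \<le> n" "\<sigma> \<in> unoriented_simplices V m k"
  shows "0 < simplex_weight m k \<sigma>"
proof -
  obtain xs where xs: "xs \<in> ordered_simplices V m k" "\<sigma> = set xs"
    using assms(2) by (auto simp: unoriented_simplices_eq)
  then show ?thesis
    using simplex_weight_eq[OF assms(1) xs(1)] weight_pos_iff[OF assms(1)] ordered_simplicesD[OF xs(1)]
    by simp
qed

section \<open>Incidence numbers\<close>

definition orientation_sign :: "'v list \<Rightarrow> real" where
  "orientation_sign xs = (if oriented xs = \<omega> (set xs) then 1 else -1)"

lemma orientation_sign_square [simp]: "orientation_sign xs * orientation_sign xs = 1"
  by (simp add: orientation_sign_def)

lemma orientation_sign_cong: "ys \<in> oriented xs \<Longrightarrow> orientation_sign ys = orientation_sign xs"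
  by (simp add: orientation_sign_def oriented_eq_if_mem set_eq_if_mem_oriented)

lemma reference_representative:
  assumes k: "k \<in> {n - 1, n}" and \<sigma>: "\<sigma> \<in> unoriented_simplices V m k"
  obtains ws where "ws \<in> ordered_simplices V m k" "\<omega> \<sigma> = oriented ws" "set ws = \<sigma>"
    "orientation_sign ws = 1"
proof -
  have "\<omega> \<sigma> \<in> oriented_simplices V m k" "underlying (\<omega> \<sigma>) = \<sigma>"
    using reference k \<sigma> unfolding reference_orientation_def by blast+
  then obtain ws where "ws \<in> ordered_simplices V m k" "\<omega> \<sigma> = oriented ws" "set ws = \<sigma>"
    by (auto simp: oriented_simplices_eq underlying_oriented)
  with that show thesis by (simp add: orientation_sign_def)
qed

text \<open>A simplex has exactly two orientations, so the comparison with the reference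
  orientation is itself alternating.\<close>

lemma orientation_sign_permute:
  assumes k: "k \<in> {n - 1, n}" and xs: "xs \<in> ordered_simplices V m k"
    and \<pi>: "\<pi> permutes {..<length xs}"
  shows "orientation_sign (permute_list \<pi> xs) = of_int (sign \<pi>) * orientation_sign xs"
proof (cases "evenperm \<pi>")
  case True
  then show ?thesis
    using \<pi> oriented_permute_even[OF \<pi> True] by (simp add: orientation_sign_def sign_def)
next
  case False
  have xs_distinct: "distinct xs" using xs by (simp add: ordered_simplices_def)
  obtain ws where ws: "ws \<in> ordered_simplices V m k" "\<omega> (set xs) = oriented ws" "set ws = set xs"
    using reference_representative[OF k mem_unoriented_if_ordered[OF xs]] by metis
  obtain \<rho> where \<rho>: "\<rho> permutes {..<length xs}" "ws = permute_list \<rho> xs"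
    using exists_permute_list ws(1,3) xs_distinct ordered_simplicesD(2) by metis
  have "oriented (permute_list \<pi> xs) = oriented ws" if odd: "\<not> evenperm \<rho>"
  proof -
    let ?\<phi> = "inv \<pi> \<circ> \<rho>"
    have inv: "inv \<pi> permutes {..<length xs}" using \<pi> by (rule permutes_inv)
    have "evenperm (inv \<pi>) = evenperm \<pi>"
      using \<pi> permutes_imp_permutation[of "{..<length xs}"] by (simp add: evenperm_inv)
    then have \<phi>: "?\<phi> permutes {..<length xs}" "evenperm ?\<phi>"
      using odd False evenperm_permutes_compose[OF _ inv \<rho>(1)] permutes_compose[OF \<rho>(1) inv] by auto
    have "\<pi> \<circ> ?\<phi> = \<rho>" using permutes_inv_o(1)[OF \<pi>] by (simp flip: comp_assoc)
    then have "ws = permute_list ?\<phi> (permute_list \<pi> xs)"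
      using permute_list_compose[OF \<phi>(1), of \<pi>] \<rho>(2) by simp
    then show ?thesis using oriented_permute_even[of ?\<phi> "permute_list \<pi> xs"] \<phi> by simp
  qed
  moreover have "oriented xs = oriented ws" if "evenperm \<rho>"
    using oriented_permute_even[OF \<rho>(1) that] \<rho>(2) by simp
  ultimately show ?thesis
    using False \<pi> ws(2) oriented_permute_odd[OF xs_distinct \<pi> False]
    by (auto simp: orientation_sign_def sign_def)
qed

lemma orientation_sign_square_complex [simp]:
  "complex_of_real (orientation_sign xs) * (of_real (orientation_sign xs) * c) = c"
  by (simp add: orientation_sign_def)

text \<open>A cochain is determined by its values at the reference orientations.\<close>

lemma cochain_eq:
  assumes k: "k \<in> {n - 1, n}" and f: "f \<in> cochains V m k" and xs: "xs \<in> ordered_simplices V m k"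
  shows "f (oriented xs) = of_real (orientation_sign xs) * f (\<omega> (set xs))"
proof -
  obtain ws where ws: "ws \<in> ordered_simplices V m k" "\<omega> (set xs) = oriented ws" "set ws = set xs"
    "orientation_sign ws = 1"
    using reference_representative[OF k mem_unoriented_if_ordered[OF xs]] by metis
  obtain \<pi> where \<pi>: "\<pi> permutes {..<length xs}" "ws = permute_list \<pi> xs"
    using exists_permute_list ws(1,3) xs ordered_simplicesD(2) by metis
  have "f (oriented ws) = of_int (sign \<pi>) * f (oriented xs)"
    using f xs \<pi> by (auto simp: cochains_def ordered_simplicesD(1)[OF xs])
  moreover have "of_int (sign \<pi>) = orientation_sign xs"
    using orientation_sign_permute[OF k xs \<pi>(1)] ws(4) \<pi>(2)
    by (cases "evenperm \<pi>") (auto simp: sign_def)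
  ultimately show ?thesis
    using ws(2) orientation_sign_square_complex[of xs "f (oriented xs)"] by (metis of_real_of_int_eq)
qed

text \<open>A converse of the preceding lemma, with \<open>c\<close> as the prescribed values.\<close>

lemma cochainI:
  assumes k: "k \<in> {n - 1, n}" and zero: "\<And>s. s \<notin> oriented_simplices V m k \<Longrightarrow> f s = 0"
    and eq: "\<And>xs. xs \<in> ordered_simplices V m k \<Longrightarrow>
      f (oriented xs) = of_real (orientation_sign xs) * c (set xs)"
  shows "f \<in> cochains V m k"
  unfolding cochains_def
proof (intro CollectI conjI allI impI ballI)
  fix xs \<pi> assume xs: "xs \<in> ordered_simplices V m k" and \<pi>: "\<pi> permutes {..<Suc k}"
  have \<pi>': "\<pi> permutes {..<length xs}" using \<pi> ordered_simplicesD(1)[OF xs] by simp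
  show "f (oriented (permute_list \<pi> xs)) = of_int (sign \<pi>) * f (oriented xs)"
    using eq[OF xs] eq[OF ordered_simplices_permute[OF xs \<pi>']] orientation_sign_permute[OF k xs \<pi>'] \<pi>'
    by simp
qed (use zero in auto)

text \<open>The vertex of \<open>\<sigma>\<close> outside \<open>\<tau>\<close> is put in front of a positively oriented ordering of \<open>\<tau>\<close>, and
  the result is compared with the reference orientation of \<open>\<sigma>\<close>.\<close>

definition incidence :: "'v set \<Rightarrow> 'v set \<Rightarrow> real" where
  "incidence \<tau> \<sigma> = orientation_sign (the_elem (\<sigma> - \<tau>) # representative (\<omega> \<tau>))"

lemma incidence_unit: "incidence \<tau> \<sigma> \<in> {-1, 1}"
  by (simp add: incidence_def orientation_sign_def)

lemma incidence_square [simp]: "incidence \<tau> \<sigma> * incidence \<tau> \<sigma> = 1"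
  by (simp add: incidence_def)

lemma incidence_Cons:
  assumes zs: "zs \<in> ordered_simplices V m (n - 1)" and x: "x # zs \<in> ordered_simplices V m n"
  shows "incidence (set zs) (insert x (set zs)) = orientation_sign (x # zs) * orientation_sign zs"
proof -
  obtain ws where ws: "ws \<in> ordered_simplices V m (n - 1)" "\<omega> (set zs) = oriented ws"
    "set ws = set zs" "orientation_sign ws = 1"
    using reference_representative[OF _ mem_unoriented_if_ordered[OF zs]] by auto
  define ys where "ys = representative (\<omega> (set zs))"
  have "ys \<in> oriented ws" using representative_mem[of ws] by (simp add: ys_def ws)
  then have ys: "ys \<in> ordered_simplices V m (n - 1)" "set ys = set zs" "orientation_sign ys = 1"
    using ordered_simplices_oriented[OF ws(1)] set_eq_if_mem_oriented[of ys ws]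
      orientation_sign_cong[of ys ws] ws(3,4) by simp_all
  obtain \<pi> where \<pi>: "\<pi> permutes {..<length zs}" "ys = permute_list \<pi> zs"
    using exists_permute_list[of zs ys] zs ys ordered_simplicesD(2) by metis
  obtain \<rho> where \<rho>: "\<rho> permutes {..<length (x # zs)}" "sign \<rho> = sign \<pi>"
    "permute_list \<rho> (x # zs) = x # ys"
    using permute_list_Cons_lift[OF \<pi>(1)] \<pi>(2) by metis
  have "insert x (set zs) - set zs = {x}"
    using ordered_simplicesD(2)[OF x] by auto
  then have "incidence (set zs) (insert x (set zs)) = orientation_sign (x # ys)"
    by (simp add: incidence_def ys_def)
  also have "\<dots> = of_int (sign \<pi>) * orientation_sign (x # zs)"
    using orientation_sign_permute[OF _ x \<rho>(1)] \<rho> by simp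
  also have "of_int (sign \<pi>) = orientation_sign zs"
    using orientation_sign_permute[OF _ zs \<pi>(1)] \<pi>(2) ys(3)
    by (cases "evenperm \<pi>") (auto simp: sign_def)
  finally show ?thesis by simp
qed

text \<open>Moving the \<open>i\<close>-th vertex to the front costs the sign \<open>(-1) ^ i\<close>, so the alternating sign of
  the coboundary is absorbed by the incidence number.\<close>

lemma coboundary_term:
  assumes xs: "xs \<in> ordered_simplices V m n" and i: "i \<le> n" and f: "f \<in> cochains V m (n - 1)"
  shows "(-1) ^ i * f (oriented (take i xs @ drop (Suc i) xs)) =
    of_real (orientation_sign xs * incidence (set xs - {xs ! i}) (set xs)) * f (\<omega> (set xs - {xs ! i}))"
proof -
  let ?x = "xs ! i" and ?zs = "take i xs @ drop (Suc i) xs"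
  have len: "i < length xs" using xs i by (simp add: ordered_simplices_def)
  have split: "take i xs @ ?x # drop (Suc i) xs = xs"
    using id_take_nth_drop[OF len] by (rule sym)
  have "length (take i xs) = i" using len by simp
  then obtain \<pi> where \<pi>: "\<pi> permutes {..<length xs}" "sign \<pi> = (-1) ^ i" "?x # ?zs = permute_list \<pi> xs"
    using move_to_front[of "take i xs" ?x "drop (Suc i) xs"] unfolding split by auto
  have Cons: "?x # ?zs \<in> ordered_simplices V m n"
    using ordered_simplices_permute[OF xs \<pi>(1)] by (simp add: \<pi>(3))
  then have zs: "?zs \<in> ordered_simplices V m (n - 1)"
    using Suc_dim by (auto simp: ordered_simplices_def)
  have set: "insert ?x (set ?zs) = set xs"
    using \<pi>(3) set_permute_list[OF \<pi>(1)] by (metis list.simps(15))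
  moreover have "?x \<notin> set ?zs"
    using ordered_simplicesD(2)[OF Cons] by (metis distinct.simps(2))
  ultimately have zs_set: "set ?zs = set xs - {?x}" by blast
  have "incidence (set xs - {?x}) (set xs) = (-1) ^ i * orientation_sign xs * orientation_sign ?zs"
    using incidence_Cons[OF zs Cons, unfolded set, unfolded zs_set]
      orientation_sign_permute[OF _ xs \<pi>(1)] \<pi>(2,3) by simp
  then have "orientation_sign xs * incidence (set xs - {?x}) (set xs) = (-1) ^ i * orientation_sign ?zs"
    by (simp add: mult.left_commute orientation_sign_def)
  then show ?thesis
    using cochain_eq[OF _ f zs, unfolded zs_set] by simp
qed

lemma coboundary_oriented:
  assumes f: "f \<in> cochains V m (n - 1)" and xs: "xs \<in> ordered_simplices V m n"
  shows "coboundary V m n f (oriented xs) = of_real (orientation_sign xs) *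
    (\<Sum>\<tau>\<in>facets (set xs). of_real (incidence \<tau> (set xs)) * f (\<omega> \<tau>))"
proof -
  let ?ys = "representative (oriented xs)"
  have ys: "?ys \<in> ordered_simplices V m n" "set ?ys = set xs" "orientation_sign ?ys = orientation_sign xs"
    using representative_mem ordered_simplices_oriented[OF xs] set_eq_if_mem_oriented orientation_sign_cong
    by blast+
  have bij: "bij_betw (\<lambda>i. set xs - {?ys ! i}) {0..n} (facets (set xs))"
  proof -
    have "bij_betw ((!) ?ys) {0..n} (set xs)"
      using bij_betw_nth[of ?ys "{0..n}" "set xs"] ordered_simplicesD[OF ys(1)] ys(2) by fastforce
    moreover have "bij_betw (\<lambda>x. set xs - {x}) (set xs) (facets (set xs))"
      using inj_on_remove by (auto simp: bij_betw_def facets_def)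
    ultimately show ?thesis using bij_betw_trans by (fastforce simp: comp_def)
  qed
  have "coboundary V m n f (oriented xs)
      = (\<Sum>i=0..n. (-1) ^ i * f (oriented (take i ?ys @ drop (Suc i) ?ys)))"
    using mem_oriented_simplices_if_ordered[OF xs] by (simp add: coboundary_def Let_def)
  also have "\<dots> = (\<Sum>i=0..n. of_real (orientation_sign xs) *
      (of_real (incidence (set xs - {?ys ! i}) (set xs)) * f (\<omega> (set xs - {?ys ! i}))))"
    using coboundary_term[OF ys(1) _ f] by (intro sum.cong) (simp_all add: ys)
  also have "\<dots> = (\<Sum>\<tau>\<in>facets (set xs). of_real (orientation_sign xs) *
      (of_real (incidence \<tau> (set xs)) * f (\<omega> \<tau>)))"
    by (rule sum.reindex_bij_betw[OF bij])
  finally show ?thesis by (simp add: sum_distrib_left)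
qed

lemma codifferential_oriented:
  assumes g: "g \<in> cochains V m n" and xs: "xs \<in> ordered_simplices V m (n - 1)"
  shows "codifferential V m n g (oriented xs) = of_real (orientation_sign xs) *
    (\<Sum>\<sigma>\<in>cofacets V m n (set xs). of_real (incidence (set xs) \<sigma> *
       simplex_weight m n \<sigma> / simplex_weight m (n - 1) (set xs)) * g (\<omega> \<sigma>))"
proof -
  let ?ys = "representative (oriented xs)" and ?w = "simplex_weight m (n - 1) (set xs)"
  let ?L = "\<Inter>y\<in>set ?ys. neighbours V m y"
  have ys: "?ys \<in> ordered_simplices V m (n - 1)" "set ?ys = set xs"
      "orientation_sign ?ys = orientation_sign xs"
    using representative_mem ordered_simplices_oriented[OF xs] set_eq_if_mem_oriented orientation_sign_cong
    by blast+
  \<comment> \<open>The summand depends on the added vertex \<open>x\<close> only through the simplex \<open>\<sigma> = insert x \<tau>\<close>.\<close>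
  define F where "F \<sigma> = complex_of_real (orientation_sign xs * incidence (set xs) \<sigma> *
      simplex_weight m n \<sigma> / ?w) * g (\<omega> \<sigma>)" for \<sigma>
  have "m (n - 1) ?ys = ?w"
    using simplex_weight_eq[OF _ ys(1)] ys(2) by simp
  then have "codifferential V m n g (oriented xs)
      = 1 / of_real ?w * (\<Sum>x\<in>?L. of_real (m n (x # ?ys)) * g (oriented (x # ?ys)))"
    using mem_oriented_simplices_if_ordered[OF xs] by (simp add: codifferential_def Let_def)
  also have "\<dots> = (\<Sum>x\<in>?L. F (insert x (set ?ys)))"
    unfolding sum_distrib_left
  proof (rule sum.cong)
    fix x assume "x \<in> ?L"
    then have x: "x # ?ys \<in> ordered_simplices V m n" using Cons_simplex_iff[OF ys(1)] by blast
    have "orientation_sign (x # ?ys) = orientation_sign xs * incidence (set xs) (insert x (set xs))"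
      using incidence_Cons[OF ys(1) x] ys(2,3) by (simp add: mult.left_commute)
    then show "1 / of_real ?w * (of_real (m n (x # ?ys)) * g (oriented (x # ?ys))) = F (insert x (set ?ys))"
      using cochain_eq[OF _ g x] simplex_weight_eq[OF _ x] ys(2) by (simp add: F_def)
  qed simp
  also have "\<dots> = (\<Sum>\<sigma>\<in>cofacets V m n (set ?ys). F \<sigma>)"
    by (rule sum.reindex_bij_betw[OF bij_betw_link_cofacets[OF ys(1)]])
  finally show ?thesis
    by (simp add: F_def ys(2) sum_distrib_left mult.assoc)
qed

lemma codifferential_cochain: "g \<in> cochains V m n \<Longrightarrow> codifferential V m n g \<in> cochains V m (n - 1)"
  by (rule cochainI[OF _ _ codifferential_oriented]) (auto simp: codifferential_def)

lemma coboundary_cochain: "f \<in> cochains V m (n - 1) \<Longrightarrow> coboundary V m n f \<in> cochains V m n"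
  by (rule cochainI[OF _ _ coboundary_oriented]) (auto simp: coboundary_def)

lemma hodge_laplacian_cochain: "f \<in> cochains V m n \<Longrightarrow> hodge_laplacian V m n f \<in> cochains V m n"
  unfolding hodge_laplacian_def by (intro coboundary_cochain codifferential_cochain)

lemma coboundary_reference:
  assumes f: "f \<in> cochains V m (n - 1)" and \<sigma>: "\<sigma> \<in> unoriented_simplices V m n"
  shows "coboundary V m n f (\<omega> \<sigma>) = (\<Sum>\<tau>\<in>facets \<sigma>. of_real (incidence \<tau> \<sigma>) * f (\<omega> \<tau>))"
proof -
  obtain ws where "ws \<in> ordered_simplices V m n" "\<omega> \<sigma> = oriented ws" "set ws = \<sigma>"
    "orientation_sign ws = 1"
    using reference_representative[OF _ \<sigma>] by auto
  then show ?thesis using coboundary_oriented[OF f] by simp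
qed

lemma codifferential_reference:
  assumes g: "g \<in> cochains V m n" and \<tau>: "\<tau> \<in> unoriented_simplices V m (n - 1)"
  shows "codifferential V m n g (\<omega> \<tau>) = (\<Sum>\<sigma>\<in>cofacets V m n \<tau>. of_real (incidence \<tau> \<sigma> *
       simplex_weight m n \<sigma> / simplex_weight m (n - 1) \<tau>) * g (\<omega> \<sigma>))"
proof -
  obtain ws where "ws \<in> ordered_simplices V m (n - 1)" "\<omega> \<tau> = oriented ws" "set ws = \<tau>"
    "orientation_sign ws = 1"
    using reference_representative[OF _ \<tau>] by auto
  then show ?thesis using codifferential_oriented[OF g] by simp
qed

lemma coboundary_coefficients_incidence: "coboundary_coefficients V m n \<omega> incidence"
  using incidence_unit by (auto simp: coboundary_coefficients_def coboundary_reference)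

end

section \<open>The unitary onto the line-complex\<close>

text \<open>Each unoriented \<open>k\<close>-simplex has \<open>(k + 1)!\<close> orderings; this accounts for the normalising factor in
  the inner product of cochains.\<close>

lemma has_sum_orderings:
  fixes h :: "'v set \<Rightarrow> 'b::real_normed_field"
  assumes h: "(h has_sum s) (unoriented_simplices V m k)"
  shows "((\<lambda>xs. h (set xs)) has_sum (fact (k + 1) * s)) (ordered_simplices V m k)"
proof -
  let ?S = "unoriented_simplices V m k" and ?O = "ordered_simplices V m k"
  let ?P = "{\<pi>. \<pi> permutes {..<Suc k}}"
  define R where "R = inv_into ?O set"
  have R: "R \<sigma> \<in> ?O" "set (R \<sigma>) = \<sigma>" if "\<sigma> \<in> ?S" for \<sigma>
    using that unfolding R_def unoriented_simplices_eq by (rule inv_into_into, rule f_inv_into_f)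
  \<comment> \<open>With one ordering \<open>R \<sigma>\<close> of each simplex, every permutation \<open>\<pi>\<close> gives a copy of the set of
    simplices, and these copies partition the ordered simplices.\<close>
  let ?B = "\<lambda>\<pi>. (\<lambda>\<sigma>. permute_list \<pi> (R \<sigma>)) ` ?S"
  have perm: "\<pi> permutes {..<length (R \<sigma>)}" if "\<pi> \<in> ?P" "\<sigma> \<in> ?S" for \<pi> \<sigma>
    using that ordered_simplicesD(1)[OF R(1)] by simp
  have set_perm: "set (permute_list \<pi> (R \<sigma>)) = \<sigma>" if "\<pi> \<in> ?P" "\<sigma> \<in> ?S" for \<pi> \<sigma>
    using that perm R by simp
  have part: "((\<lambda>xs. h (set xs)) has_sum s) (?B \<pi>)" if \<pi>: "\<pi> \<in> ?P" for \<pi>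
  proof -
    have inj: "inj_on (\<lambda>\<sigma>. permute_list \<pi> (R \<sigma>)) ?S"
      by (rule inj_on_inverseI[where g = set]) (rule set_perm[OF \<pi>])
    have "(h has_sum s) ?S \<longleftrightarrow> ((\<lambda>\<sigma>. h (set (permute_list \<pi> (R \<sigma>)))) has_sum s) ?S"
      by (rule has_sum_cong) (simp only: set_perm[OF \<pi>])
    with h show ?thesis
      by (simp only: has_sum_reindex[OF inj] comp_def)
  qed
  have disjoint: "?B \<pi> \<inter> ?B \<rho> = {}" if P: "\<pi> \<in> ?P" "\<rho> \<in> ?P" and ne: "\<pi> \<noteq> \<rho>" for \<pi> \<rho>
  proof (rule ccontr)
    assume "?B \<pi> \<inter> ?B \<rho> \<noteq> {}"
    then obtain \<sigma> \<sigma>' where \<sigma>: "\<sigma> \<in> ?S" "\<sigma>' \<in> ?S" "permute_list \<pi> (R \<sigma>) = permute_list \<rho> (R \<sigma>')"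
      by auto
    have "\<sigma> = set (permute_list \<rho> (R \<sigma>'))"
      using set_perm[OF P(1) \<sigma>(1)] \<sigma>(3) by simp
    also have "\<dots> = \<sigma>'" by (rule set_perm[OF P(2) \<sigma>(2)])
    finally have "permute_list \<pi> (R \<sigma>) = permute_list \<rho> (R \<sigma>)" using \<sigma>(3) by simp
    then have "\<pi> = \<rho>"
      by (rule permute_list_inj[OF ordered_simplicesD(2)[OF R(1)[OF \<sigma>(1)]]
            perm[OF P(1) \<sigma>(1)] perm[OF P(2) \<sigma>(1)]])
    with ne show False ..
  qed
  have union: "(\<Union>\<pi>\<in>?P. ?B \<pi>) = ?O"
  proof
    show "(\<Union>\<pi>\<in>?P. ?B \<pi>) \<subseteq> ?O" using R(1) perm ordered_simplices_permute by blast
    show "?O \<subseteq> (\<Union>\<pi>\<in>?P. ?B \<pi>)"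
    proof
      fix xs assume xs: "xs \<in> ?O"
      then have S: "set xs \<in> ?S" by (rule mem_unoriented_if_ordered)
      obtain \<pi> where "\<pi> permutes {..<length (R (set xs))}" "xs = permute_list \<pi> (R (set xs))"
        by (rule exists_permute_list[OF ordered_simplicesD(2)[OF R(1)[OF S]] ordered_simplicesD(2)[OF xs]
              R(2)[OF S]])
      then show "xs \<in> (\<Union>\<pi>\<in>?P. ?B \<pi>)"
        using S ordered_simplicesD(1)[OF R(1)[OF S]] by auto
    qed
  qed
  have "finite ?P" by (simp add: finite_permutations)
  then have "((\<lambda>xs. h (set xs)) has_sum (\<Sum>\<pi>\<in>?P. s)) (\<Union>\<pi>\<in>?P. ?B \<pi>)"
    using part disjoint by (rule sum_has_sum)
  moreover have "(\<Sum>\<pi>\<in>?P. s) = fact (k + 1) * s"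
    using card_permutations[of "{..<Suc k}" "Suc k"] by (simp del: fact_Suc)
  ultimately show ?thesis by (simp only: union)
qed

lemma summable_on_orderings_iff:
  fixes h :: "'v set \<Rightarrow> 'b::{real_normed_field, banach}"
  shows "(\<lambda>xs. h (set xs)) summable_on ordered_simplices V m k \<longleftrightarrow> h summable_on unoriented_simplices V m k"
proof
  assume sum: "(\<lambda>xs. h (set xs)) summable_on ordered_simplices V m k"
  define R where "R = inv_into (ordered_simplices V m k) set"
  have R: "R \<sigma> \<in> ordered_simplices V m k" "set (R \<sigma>) = \<sigma>" if "\<sigma> \<in> unoriented_simplices V m k" for \<sigma>
    using that unfolding R_def unoriented_simplices_eq by (rule inv_into_into, rule f_inv_into_f)
  have inj: "inj_on R (unoriented_simplices V m k)"
    by (rule inj_on_inverseI[where g = set]) (rule R(2))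
  have "(\<lambda>xs. h (set xs)) summable_on R ` unoriented_simplices V m k"
    using sum by (rule summable_on_subset_banach) (use R(1) in blast)
  then have "(\<lambda>\<sigma>. h (set (R \<sigma>))) summable_on unoriented_simplices V m k"
    by (simp only: summable_on_reindex[OF inj] comp_def)
  also have "?this \<longleftrightarrow> h summable_on unoriented_simplices V m k"
    by (rule summable_on_cong) (simp only: R(2))
  finally show "h summable_on unoriented_simplices V m k" .
next
  assume "h summable_on unoriented_simplices V m k"
  then show "(\<lambda>xs. h (set xs)) summable_on ordered_simplices V m k"
    using has_sum_orderings unfolding summable_on_def by blast
qed

context oriented_complex
begin

abbreviation (input) top_simplices :: "'v set set" where
  "top_simplices \<equiv> unoriented_simplices V m n"

abbreviation (input) H :: "'v list set inner_space" where
  "H \<equiv> l2_cochains V m n"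

abbreviation (input) L :: "'v set inner_space" where
  "L \<equiv> l2_counting top_simplices"

text \<open>The factor \<open>sqrt (m\<^sub>n \<sigma>)\<close> turns the weighted norm of cochains into the counting norm.\<close>

definition to_line :: "('v list set \<Rightarrow> complex) \<Rightarrow> 'v set \<Rightarrow> complex" where
  "to_line f \<sigma> = (if \<sigma> \<in> top_simplices then of_real (sqrt (simplex_weight m n \<sigma>)) * f (\<omega> \<sigma>) else 0)"

definition from_line :: "('v set \<Rightarrow> complex) \<Rightarrow> 'v list set \<Rightarrow> complex" where
  "from_line g s = (if s \<in> oriented_simplices V m n
     then of_real (orientation_sign (representative s)) *
       (g (underlying s) / of_real (sqrt (simplex_weight m n (underlying s))))
     else 0)"

lemma top_weight_pos: "\<sigma> \<in> top_simplices \<Longrightarrow> 0 < simplex_weight m n \<sigma>"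
  by (rule simplex_weight_pos) simp

lemma from_line_oriented:
  assumes "xs \<in> ordered_simplices V m n"
  shows "from_line g (oriented xs) = of_real (orientation_sign xs) *
    (g (set xs) / of_real (sqrt (simplex_weight m n (set xs))))"
  using mem_oriented_simplices_if_ordered[OF assms] orientation_sign_cong[OF representative_mem, of xs]
  by (simp add: from_line_def underlying_oriented)

lemma from_line_cochain: "from_line g \<in> cochains V m n"
  by (rule cochainI[OF _ _ from_line_oriented]) (auto simp: from_line_def)

lemma from_line_lincomb:
  "from_line (\<lambda>x. a * f x + b * g x) = (\<lambda>s. a * from_line f s + b * from_line g s)"
  by (rule ext) (simp add: from_line_def field_simps add_divide_distrib)

lemma to_line_lincomb:
  "to_line (\<lambda>x. a * f x + b * g x) = (\<lambda>s. a * to_line f s + b * to_line g s)"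
  by (rule ext) (simp add: to_line_def algebra_simps)

lemma to_line_from_line:
  assumes "\<And>\<sigma>. \<sigma> \<notin> top_simplices \<Longrightarrow> g \<sigma> = 0"
  shows "to_line (from_line g) = g"
proof
  fix \<sigma>
  show "to_line (from_line g) \<sigma> = g \<sigma>"
  proof (cases "\<sigma> \<in> top_simplices")
    case True
    then obtain ws where "ws \<in> ordered_simplices V m n" "\<omega> \<sigma> = oriented ws" "set ws = \<sigma>"
      "orientation_sign ws = 1"
      using reference_representative by blast
    then show ?thesis
      using True top_weight_pos[OF True] by (simp add: to_line_def from_line_oriented)
  qed (simp add: to_line_def assms)
qed

lemma inj_on_to_line: "inj_on to_line (cochains V m n)"
proof (rule inj_onI)
  fix f g assume f: "f \<in> cochains V m n" and g: "g \<in> cochains V m n" and eq: "to_line f = to_line g"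
  have ref: "f (\<omega> \<sigma>) = g (\<omega> \<sigma>)" if "\<sigma> \<in> top_simplices" for \<sigma>
    using fun_cong[OF eq, of \<sigma>] that top_weight_pos[OF that] by (simp add: to_line_def)
  show "f = g"
  proof
    fix s
    show "f s = g s"
    proof (cases "s \<in> oriented_simplices V m n")
      case True
      then obtain xs where xs: "xs \<in> ordered_simplices V m n" "s = oriented xs"
        by (auto simp: oriented_simplices_eq)
      then show ?thesis
        using cochain_eq[OF _ f xs(1)] cochain_eq[OF _ g xs(1)] ref mem_unoriented_if_ordered[OF xs(1)]
        by simp
    qed (use f g in \<open>simp add: cochains_def\<close>)
  qed
qed

lemma to_line_mult_cnj:
  assumes f: "f \<in> cochains V m n" and g: "g \<in> cochains V m n" and xs: "xs \<in> ordered_simplices V m n"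
  shows "of_real (m n xs) * f (oriented xs) * cnj (g (oriented xs))
    = to_line f (set xs) * cnj (to_line g (set xs))"
proof -
  have \<sigma>: "set xs \<in> top_simplices" using xs by (rule mem_unoriented_if_ordered)
  have "complex_of_real (m n xs)
      = of_real (sqrt (simplex_weight m n (set xs))) * of_real (sqrt (simplex_weight m n (set xs)))"
    using simplex_weight_eq[OF _ xs] top_weight_pos[OF \<sigma>] by (simp flip: of_real_mult)
  then show ?thesis
    using \<sigma> cochain_eq[OF _ f xs] cochain_eq[OF _ g xs]
    by (simp add: to_line_def orientation_sign_def)
qed

lemma to_line_cmod:
  assumes f: "f \<in> cochains V m n" and xs: "xs \<in> ordered_simplices V m n"
  shows "m n xs * (cmod (f (oriented xs)))\<^sup>2 = (cmod (to_line f (set xs)))\<^sup>2"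
proof -
  have "complex_of_real (m n xs * (cmod (f (oriented xs)))\<^sup>2) = of_real ((cmod (to_line f (set xs)))\<^sup>2)"
    using to_line_mult_cnj[OF f f xs] by (simp only: of_real_mult complex_norm_square mult.assoc)
  then show ?thesis by (simp only: of_real_eq_iff)
qed

lemma vecs_l2_cochains_iff:
  "f \<in> vecs H \<longleftrightarrow> f \<in> cochains V m n \<and> to_line f \<in> vecs L"
proof (cases "f \<in> cochains V m n")
  case True
  have "(\<lambda>xs. m n xs * (cmod (f (oriented xs)))\<^sup>2) summable_on ordered_simplices V m n \<longleftrightarrow>
      (\<lambda>xs. (cmod (to_line f (set xs)))\<^sup>2) summable_on ordered_simplices V m n"
    by (rule summable_on_cong) (rule to_line_cmod[OF True])
  also have "\<dots> \<longleftrightarrow> (\<lambda>\<sigma>. (cmod (to_line f \<sigma>))\<^sup>2) summable_on top_simplices"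
    by (rule summable_on_orderings_iff)
  finally show ?thesis
    using True by (simp add: l2_cochains_def vecs_l2_counting to_line_def)
qed (simp add: l2_cochains_def)

lemma to_line_isometric:
  assumes f: "f \<in> vecs H" and g: "g \<in> vecs H"
  shows "ip L (to_line f) (to_line g) = ip H f g"
proof -
  let ?h = "\<lambda>\<sigma>. to_line f \<sigma> * cnj (to_line g \<sigma>)"
  have c: "f \<in> cochains V m n" "g \<in> cochains V m n" using f g by (auto simp: vecs_l2_cochains_iff)
  have "?h summable_on top_simplices"
    using f g by (intro summable_mult_cnj) (auto simp: vecs_l2_cochains_iff vecs_l2_counting)
  then have "((\<lambda>xs. ?h (set xs)) has_sum (fact (n + 1) * infsum ?h top_simplices)) (ordered_simplices V m n)"
    by (intro has_sum_orderings has_sum_infsum)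
  then have "infsum (\<lambda>xs. ?h (set xs)) (ordered_simplices V m n) = fact (n + 1) * ip L (to_line f) (to_line g)"
    by (simp add: infsumI ip_l2_counting)
  moreover have "ip H f g = 1 / fact (n + 1) * infsum (\<lambda>xs. ?h (set xs)) (ordered_simplices V m n)"
    using to_line_mult_cnj[OF c] by (simp add: l2_cochains_def cong: infsum_cong)
  ultimately show ?thesis by (simp del: fact_Suc)
qed

lemma from_line_mem: "g \<in> vecs L \<Longrightarrow> from_line g \<in> vecs H"
  using from_line_cochain to_line_from_line[of g] by (simp add: vecs_l2_cochains_iff vecs_l2_counting)

lemma to_line_from_line_l2: "g \<in> vecs L \<Longrightarrow> to_line (from_line g) = g"
  by (rule to_line_from_line) (simp add: vecs_l2_counting)

lemma inj_on_to_line_l2: "inj_on to_line (vecs H)"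
  by (rule inj_on_subset[OF inj_on_to_line]) (auto simp: vecs_l2_cochains_iff)

lemma zero_cochain: "(\<lambda>s. 0) \<in> cochains V m k"
  by (simp add: cochains_def)

lemma lincomb_cochain:
  "f \<in> cochains V m k \<Longrightarrow> g \<in> cochains V m k \<Longrightarrow> (\<lambda>s. a * f s + b * g s) \<in> cochains V m k"
  by (simp add: cochains_def algebra_simps)

lemma linear_on_to_line: "linear_on (vecs H) to_line"
proof -
  have "to_line (\<lambda>s. 0) = (\<lambda>\<sigma>. 0)" by (auto simp: to_line_def)
  then show ?thesis
    using l2_counting.lincomb_mem l2_counting.zero_mem
    by (auto simp: linear_on_def vecs_l2_cochains_iff to_line_lincomb zero_cochain lincomb_cochain)
qed

lemma unitary_to_line: "unitary H L to_line"
proof -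
  have "to_line ` vecs H = vecs L"
  proof
    show "to_line ` vecs H \<subseteq> vecs L" by (auto simp: vecs_l2_cochains_iff)
    show "vecs L \<subseteq> to_line ` vecs H"
    proof
      fix g assume "g \<in> vecs L"
      then show "g \<in> to_line ` vecs H"
        by (intro image_eqI[of _ _ "from_line g"]) (simp_all add: from_line_mem to_line_from_line_l2)
    qed
  qed
  then show ?thesis
    by (simp add: unitary_def bij_betw_def inj_on_to_line_l2 linear_on_to_line to_line_isometric)
qed

lemma inv_into_to_line: "g \<in> vecs L \<Longrightarrow> inv_into (vecs H) to_line g = from_line g"
  by (intro inv_into_f_eq inj_on_to_line_l2 from_line_mem to_line_from_line_l2)

sublocale cochain_space: inner_product_functions H
proof (rule inner_product_functions_pullback)
  show "inner_product_functions L" by (rule l2_counting.inner_product_functions_axioms)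
  show "linear_on (vecs H) to_line" by (rule linear_on_to_line)
  show "to_line ` vecs H \<subseteq> vecs L" by (auto simp: vecs_l2_cochains_iff)
qed (auto simp: inj_on_to_line_l2 to_line_isometric)

lemma vnorm_to_line: "f \<in> vecs H \<Longrightarrow> vnorm L (to_line f) = vnorm H f"
  by (simp add: vnorm_def to_line_isometric)

lemma to_line_support:
  assumes "\<And>s. s \<in> oriented_simplices V m n \<Longrightarrow> underlying s \<noteq> \<sigma> \<Longrightarrow> f s = 0"
    and "\<sigma>' \<in> top_simplices" "\<sigma>' \<noteq> \<sigma>"
  shows "to_line f \<sigma>' = 0"
proof -
  have "\<omega> \<sigma>' \<in> oriented_simplices V m n" "underlying (\<omega> \<sigma>') = \<sigma>'"
    using reference assms(2) unfolding reference_orientation_def by blast+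
  with assms show ?thesis by (simp add: to_line_def)
qed

text \<open>Truncation to a finite set of simplices on the side of the line-complex approximates any
  cochain, and a finite set of simplices carries finitely many oriented simplices.\<close>

lemma finite_cochains_dense: "dense_in H (finite_cochains V m n)"
  unfolding dense_in_def
proof (intro conjI ballI allI impI subsetI)
  fix f assume f: "f \<in> finite_cochains V m n"
  have "{\<sigma> \<in> top_simplices. to_line f \<sigma> \<noteq> 0} \<subseteq> underlying ` {s. f s \<noteq> 0}"
  proof
    fix \<sigma> assume \<sigma>: "\<sigma> \<in> {\<sigma> \<in> top_simplices. to_line f \<sigma> \<noteq> 0}"
    then have "underlying (\<omega> \<sigma>) = \<sigma>"
      using reference unfolding reference_orientation_def by blast
    with \<sigma> show "\<sigma> \<in> underlying ` {s. f s \<noteq> 0}"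
      by (auto simp: to_line_def intro!: image_eqI[of _ _ "\<omega> \<sigma>"])
  qed
  moreover have "finite (underlying ` {s. f s \<noteq> 0})"
    using f by (simp add: finite_cochains_def)
  ultimately have "finite {\<sigma> \<in> top_simplices. (cmod (to_line f \<sigma>))\<^sup>2 \<noteq> 0}"
    by (simp add: finite_subset)
  then have "to_line f \<in> vecs L"
    by (auto simp: vecs_l2_counting to_line_def intro: finite_nonzero_values_imp_summable_on)
  with f show "f \<in> vecs H" by (simp add: vecs_l2_cochains_iff finite_cochains_def)
next
  fix u and e :: real assume u: "u \<in> vecs H" and e: "0 < e"
  then have Uu: "to_line u \<in> vecs L" by (simp add: vecs_l2_cochains_iff)
  then obtain F where F: "finite F" "F \<subseteq> top_simplices"
    "vnorm L (\<lambda>\<sigma>. to_line u \<sigma> - (if \<sigma> \<in> F then to_line u \<sigma> else 0)) < e"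
    using l2_counting_finite_approx e by blast
  let ?g = "\<lambda>\<sigma>. if \<sigma> \<in> F then to_line u \<sigma> else 0"
  have g: "?g \<in> vecs L"
    using F(1) Uu by (auto simp: vecs_l2_counting intro!: finite_nonzero_values_imp_summable_on)
  have "{s. from_line ?g s \<noteq> 0} \<subseteq> oriented ` {xs. set xs \<subseteq> \<Union>F \<and> length xs = Suc n}"
  proof
    fix s assume "s \<in> {s. from_line ?g s \<noteq> 0}"
    then have s: "s \<in> oriented_simplices V m n" "underlying s \<in> F"
      by (auto simp: from_line_def split: if_splits)
    then show "s \<in> oriented ` {xs. set xs \<subseteq> \<Union>F \<and> length xs = Suc n}"
      by (auto simp: oriented_simplices_eq underlying_oriented ordered_simplicesD(1) intro!: imageI)
  qed
  moreover have "finite (\<Union>F)" using F(1,2) unoriented_simplices_finite by blast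
  ultimately have "finite {s. from_line ?g s \<noteq> 0}"
    by (rule finite_subset[OF _ finite_imageI[OF finite_lists_length_eq]])
  then have mem: "from_line ?g \<in> finite_cochains V m n"
    by (simp add: finite_cochains_def from_line_cochain)
  have diff: "(\<lambda>s. u s - from_line ?g s) \<in> vecs H"
    using u from_line_mem[OF g] by (rule cochain_space.diff_mem)
  have "vnorm H (\<lambda>s. u s - from_line ?g s) = vnorm L (to_line (\<lambda>s. u s - from_line ?g s))"
    using vnorm_to_line[OF diff] by simp
  also have "to_line (\<lambda>s. u s - from_line ?g s) = (\<lambda>\<sigma>. to_line u \<sigma> - ?g \<sigma>)"
    using linear_on_diff[OF linear_on_to_line u from_line_mem[OF g]] to_line_from_line_l2[OF g] by simp
  also have "vnorm L \<dots> < e" by (rule F(3))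
  finally show "\<exists>f\<in>finite_cochains V m n. vnorm H (\<lambda>s. u s - f s) < e" using mem by blast
qed

lemma finite_cochains_lincomb:
  assumes "f \<in> finite_cochains V m n" "g \<in> finite_cochains V m n"
  shows "(\<lambda>s. a * f s + b * g s) \<in> finite_cochains V m n"
proof -
  have "finite ({s. f s \<noteq> 0} \<union> {s. g s \<noteq> 0})" using assms by (simp add: finite_cochains_def)
  then have "finite {s. a * f s + b * g s \<noteq> 0}" by (rule rev_finite_subset) auto
  with assms show ?thesis by (simp add: finite_cochains_def lincomb_cochain)
qed

section \<open>The Hodge Laplacian on the line-complex\<close>

definition relative_sign :: "'v set \<Rightarrow> 'v set \<Rightarrow> real" where
  "relative_sign \<sigma> \<sigma>' = incidence (\<sigma> \<inter> \<sigma>') \<sigma> * incidence (\<sigma> \<inter> \<sigma>') \<sigma>'"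

lemma relative_sign_sym: "relative_sign \<sigma> \<sigma>' = relative_sign \<sigma>' \<sigma>"
  by (simp add: relative_sign_def Int_commute mult.commute)

lemma relative_sign_unit: "relative_sign \<sigma> \<sigma>' \<in> {-1, 1}"
  using incidence_unit[of "\<sigma> \<inter> \<sigma>'" \<sigma>] incidence_unit[of "\<sigma> \<inter> \<sigma>'" \<sigma>']
  by (auto simp: relative_sign_def)

lemma line_adjacent_sym: "line_adjacent V m n \<sigma> \<sigma>' \<longleftrightarrow> line_adjacent V m n \<sigma>' \<sigma>"
  by (auto simp: line_adjacent_def)

lemma line_weight_sym: "line_weight V m n \<sigma> \<sigma>' = line_weight V m n \<sigma>' \<sigma>"
  by (simp add: line_weight_def line_adjacent_sym[of \<sigma>] Int_commute mult.commute)

lemma signed_kernel_sym: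
  "signed_kernel V m n relative_sign \<sigma> \<sigma>' = signed_kernel V m n relative_sign \<sigma>' \<sigma>"
  by (simp add: signed_kernel_def relative_sign_sym[of \<sigma>] line_weight_sym[of \<sigma>])

lemma common_facet_unoriented:
  assumes "\<sigma> \<in> unoriented_simplices V m k" "\<sigma>' \<in> unoriented_simplices V m k" "\<sigma> \<noteq> \<sigma>'"
    "\<tau> \<in> facets \<sigma>" "\<tau> \<in> facets \<sigma>'"
  shows "\<tau> = \<sigma> \<inter> \<sigma>'"
  using assms unoriented_simplices_finite[OF assms(1)] unoriented_simplices_finite[OF assms(2)]
  by (intro common_facet_eq_Int) auto

lemma line_adjacent_Int_facet:
  assumes "line_adjacent V m n \<sigma>' \<sigma>"
  shows "\<sigma> \<inter> \<sigma>' \<in> facets \<sigma>" "\<sigma> \<inter> \<sigma>' \<in> facets \<sigma>'"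
proof -
  obtain \<tau> where "\<tau> \<in> facets \<sigma>" "\<tau> \<in> facets \<sigma>'" using assms by (auto simp: line_adjacent_def)
  moreover from this have "\<tau> = \<sigma> \<inter> \<sigma>'"
    using assms by (intro common_facet_unoriented[of \<sigma> n]) (auto simp: line_adjacent_def)
  ultimately show "\<sigma> \<inter> \<sigma>' \<in> facets \<sigma>" "\<sigma> \<inter> \<sigma>' \<in> facets \<sigma>'" by auto
qed

lemma line_weight_nonneg: "0 \<le> line_weight V m n \<sigma> \<sigma>'"
proof (cases "line_adjacent V m n \<sigma> \<sigma>'")
  case True
  then have S: "\<sigma> \<in> top_simplices" "\<sigma>' \<in> top_simplices" by (auto simp: line_adjacent_def)
  have "\<sigma>' \<inter> \<sigma> \<in> unoriented_simplices V m (n - 1)"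
    using line_adjacent_Int_facet(1)[OF True] S by (intro facet_unoriented)
  then have "0 < simplex_weight m (n - 1) (\<sigma> \<inter> \<sigma>')"
    by (intro simplex_weight_pos) (simp_all add: Int_commute)
  with S show ?thesis
    using top_weight_pos by (simp add: line_weight_def less_imp_le)
qed (simp add: line_weight_def)

lemma abs_signed_kernel: "\<bar>signed_kernel V m n relative_sign \<sigma> \<sigma>'\<bar> = line_weight V m n \<sigma> \<sigma>'"
  using relative_sign_unit[of \<sigma> \<sigma>'] line_weight_nonneg[of \<sigma> \<sigma>']
  by (auto simp: signed_kernel_def abs_mult)

lemma finite_line_neighbours: "finite {\<sigma>'. line_adjacent V m n \<sigma>' \<sigma>}"
proof (cases "\<sigma> \<in> top_simplices")
  case True
  have "{\<sigma>'. line_adjacent V m n \<sigma>' \<sigma>} \<subseteq> (\<Union>\<tau>\<in>facets \<sigma>. cofacets V m n \<tau>)"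
    by (auto simp: line_adjacent_def cofacets_def)
  moreover have "finite (\<Union>\<tau>\<in>facets \<sigma>. cofacets V m n \<tau>)"
    using True unoriented_simplices_finite by (blast intro: finite_facets finite_cofacets facet_unoriented)
  ultimately show ?thesis by (rule finite_subset)
qed (simp add: line_adjacent_def)

lemma line_degree_eq: "line_degree V m n \<sigma> = (\<Sum>\<sigma>' | line_adjacent V m n \<sigma>' \<sigma>. line_weight V m n \<sigma> \<sigma>')"
proof -
  have "line_degree V m n \<sigma> = (\<Sum>\<^sub>\<infinity>\<sigma>' | line_adjacent V m n \<sigma>' \<sigma>. line_weight V m n \<sigma> \<sigma>')"
    unfolding line_degree_def by (rule infsum_cong_neutral) (auto simp: line_weight_def line_adjacent_def)
  then show ?thesis using finite_line_neighbours by simp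
qed

text \<open>In \<open>d \<delta> f\<close> at \<open>\<sigma>\<close>, the paths \<open>\<sigma> \<succ> \<tau> \<prec> \<sigma>\<close> that return to \<open>\<sigma>\<close> contribute the potential, since the
  incidence numbers square to one. The paths \<open>\<sigma> \<succ> \<tau> \<prec> \<sigma>'\<close> to another simplex pass through
  \<open>\<tau> = \<sigma> \<inter> \<sigma>'\<close>, and contribute the signed adjacency operator.\<close>

lemma to_line_hodge_laplacian:
  assumes f: "f \<in> cochains V m n"
  shows "to_line (hodge_laplacian V m n f) = (\<lambda>\<sigma>. signed_adjacency V m n relative_sign (to_line f) \<sigma>
    + multiplication (simplex_potential m n) (to_line f) \<sigma>)"
proof
  fix \<sigma>
  show "to_line (hodge_laplacian V m n f) \<sigma> = signed_adjacency V m n relative_sign (to_line f) \<sigma>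
    + multiplication (simplex_potential m n) (to_line f) \<sigma>"
  proof (cases "\<sigma> \<in> top_simplices")
    case False
    then have "\<not> line_adjacent V m n \<sigma>' \<sigma>" for \<sigma>' by (simp add: line_adjacent_def)
    with False show ?thesis by (simp add: to_line_def signed_adjacency_def multiplication_def)
  next
    case True
    let ?w = "simplex_weight m n" and ?w' = "simplex_weight m (n - 1)"
    let ?N = "{\<sigma>'. line_adjacent V m n \<sigma>' \<sigma>}"
    \<comment> \<open>The contribution of the path \<open>\<sigma> \<succ> \<tau> \<prec> \<sigma>'\<close>.\<close>
    define G where "G \<tau> \<sigma>' = of_real (incidence \<tau> \<sigma> * incidence \<tau> \<sigma>' * sqrt (?w \<sigma> * ?w \<sigma>') / ?w' \<tau>)
      * to_line f \<sigma>'" for \<tau> \<sigma>'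
    have fin: "finite (facets \<sigma>)" using True unoriented_simplices_finite finite_facets by blast
    have fin': "finite (cofacets V m n \<tau>)" if "\<tau> \<in> facets \<sigma>" for \<tau>
      using that True by (intro finite_cofacets facet_unoriented)
    have "of_real (sqrt (?w \<sigma>)) * (of_real (incidence \<tau> \<sigma>) * (of_real (incidence \<tau> \<sigma>' * ?w \<sigma>' / ?w' \<tau>) * f (\<omega> \<sigma>')))
        = G \<tau> \<sigma>'" if "\<sigma>' \<in> cofacets V m n \<tau>" for \<tau> \<sigma>'
    proof -
      have \<sigma>': "\<sigma>' \<in> top_simplices" using that by (simp add: cofacets_def)
      have "complex_of_real (?w \<sigma>') = of_real (sqrt (?w \<sigma>')) * of_real (sqrt (?w \<sigma>'))"
        using top_weight_pos[OF \<sigma>'] by (simp flip: of_real_mult)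
      then show ?thesis using \<sigma>' by (simp add: G_def to_line_def real_sqrt_mult)
    qed
    then have "to_line (hodge_laplacian V m n f) \<sigma> = (\<Sum>\<tau>\<in>facets \<sigma>. \<Sum>\<sigma>'\<in>cofacets V m n \<tau>. G \<tau> \<sigma>')"
      using True facet_unoriented[OF True]
      by (simp add: to_line_def hodge_laplacian_def coboundary_reference[OF codifferential_cochain[OF f]]
          codifferential_reference[OF f] sum_distrib_left)
    also have "\<dots> = (\<Sum>\<tau>\<in>facets \<sigma>. G \<tau> \<sigma> + (\<Sum>\<sigma>'\<in>cofacets V m n \<tau> - {\<sigma>}. G \<tau> \<sigma>'))"
      using fin' True by (intro sum.cong sum.remove) (auto simp: cofacets_def)
    also have "\<dots> = (\<Sum>\<tau>\<in>facets \<sigma>. G \<tau> \<sigma>) + (\<Sum>(\<tau>, \<sigma>')\<in>(SIGMA \<tau>:facets \<sigma>. cofacets V m n \<tau> - {\<sigma>}). G \<tau> \<sigma>')"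
      using fin fin' by (simp add: sum.distrib sum.Sigma)
    also have "(\<Sum>\<tau>\<in>facets \<sigma>. G \<tau> \<sigma>) = multiplication (simplex_potential m n) (to_line f) \<sigma>"
      using top_weight_pos[OF True]
      by (simp add: G_def multiplication_def simplex_potential_def sum_distrib_right)
    also have "(\<Sum>(\<tau>, \<sigma>')\<in>(SIGMA \<tau>:facets \<sigma>. cofacets V m n \<tau> - {\<sigma>}). G \<tau> \<sigma>') = (\<Sum>\<sigma>'\<in>?N. G (\<sigma> \<inter> \<sigma>') \<sigma>')"
    proof (rule sum.reindex_bij_witness[where i = "\<lambda>\<sigma>'. (\<sigma> \<inter> \<sigma>', \<sigma>')" and j = snd])
      fix p assume p: "p \<in> (SIGMA \<tau>:facets \<sigma>. cofacets V m n \<tau> - {\<sigma>})"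
      then obtain \<tau> \<sigma>' where \<tau>: "p = (\<tau>, \<sigma>')" "\<tau> \<in> facets \<sigma>" "\<tau> \<in> facets \<sigma>'"
        "\<sigma>' \<in> top_simplices" "\<sigma>' \<noteq> \<sigma>"
        by (auto simp: cofacets_def)
      then have "\<tau> = \<sigma> \<inter> \<sigma>'"
        using True by (intro common_facet_unoriented[of \<sigma> n]) auto
      then show "(\<sigma> \<inter> snd p, snd p) = p" "G (\<sigma> \<inter> snd p) (snd p) = (case p of (\<tau>, \<sigma>') \<Rightarrow> G \<tau> \<sigma>')"
        using \<tau> by auto
      show "snd p \<in> ?N" using \<tau> True by (auto simp: line_adjacent_def)
    next
      fix \<sigma>' assume "\<sigma>' \<in> ?N"
      then show "(\<sigma> \<inter> \<sigma>', \<sigma>') \<in> (SIGMA \<tau>:facets \<sigma>. cofacets V m n \<tau> - {\<sigma>})"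
        using line_adjacent_Int_facet by (auto simp: cofacets_def line_adjacent_def)
    qed simp
    also have "\<dots> = signed_adjacency V m n relative_sign (to_line f) \<sigma>"
      unfolding signed_adjacency_def
      by (rule sum.cong) (auto simp: G_def signed_kernel_def relative_sign_def line_weight_def line_adjacent_sym[of \<sigma>])
    finally show ?thesis by (simp add: add.commute)
  qed
qed

end

lemma sup_norm_bounds:
  assumes "bounded (g ` S)"
  shows "0 \<le> sup_norm S g"
    and "x \<in> S \<Longrightarrow> \<bar>g x\<bar> \<le> sup_norm S g"
proof -
  obtain b where "\<forall>x\<in>S. \<bar>g x\<bar> \<le> b" using assms by (auto simp: bounded_iff)
  then have "bdd_above (insert 0 ((\<lambda>x. \<bar>g x\<bar>) ` S))" by auto
  then show "0 \<le> sup_norm S g" "x \<in> S \<Longrightarrow> \<bar>g x\<bar> \<le> sup_norm S g"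
    unfolding sup_norm_def by (auto intro: cSup_upper)
qed

locale bounded_oriented_complex = oriented_complex V m n \<omega>
  for V :: "'v set" and m :: "nat \<Rightarrow> 'v list \<Rightarrow> real" and n :: nat and \<omega> :: "'v set \<Rightarrow> 'v list set" +
  assumes bounded_degree: "bounded (line_degree V m n ` unoriented_simplices V m n)"
    and bounded_potential: "bounded (simplex_potential m n ` unoriented_simplices V m n)"
begin

definition line_operator :: "('v set \<Rightarrow> complex) \<Rightarrow> 'v set \<Rightarrow> complex" where
  "line_operator f \<sigma> = signed_adjacency V m n relative_sign f \<sigma> + multiplication (simplex_potential m n) f \<sigma>"

definition norm_bound :: real where
  "norm_bound = sup_norm top_simplices (line_degree V m n) + sup_norm top_simplices (simplex_potential m n)"

text \<open>The potential is placed on the diagonal of the kernel, so that the Schur test applies to the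
  sum of the two operators at once and yields the sum of the two suprema as bound.\<close>

definition line_kernel :: "'v set \<Rightarrow> 'v set \<Rightarrow> real" where
  "line_kernel \<sigma> \<sigma>' = (if \<sigma>' = \<sigma> then simplex_potential m n \<sigma> else signed_kernel V m n relative_sign \<sigma> \<sigma>')"

text \<open>The first part is empty for \<open>\<sigma>\<close> outside the line-complex, whose row must be empty too.\<close>

definition closed_line_neighbours :: "'v set \<Rightarrow> 'v set set" where
  "closed_line_neighbours \<sigma> = {\<sigma>' \<in> top_simplices. \<sigma>' = \<sigma>} \<union> {\<sigma>'. line_adjacent V m n \<sigma>' \<sigma>}"

lemma abs_row_sum_signed_kernel:
  "(\<Sum>\<sigma>' | line_adjacent V m n \<sigma>' \<sigma>. \<bar>signed_kernel V m n relative_sign \<sigma> \<sigma>'\<bar>) = line_degree V m n \<sigma>"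
  by (simp add: abs_signed_kernel line_degree_eq)

sublocale adjacency: locally_finite_kernel top_simplices "\<lambda>\<sigma>. {\<sigma>'. line_adjacent V m n \<sigma>' \<sigma>}"
  "signed_kernel V m n relative_sign" "sup_norm top_simplices (line_degree V m n)"
proof
  show "(\<Sum>\<sigma>'\<in>{\<sigma>'. line_adjacent V m n \<sigma>' \<sigma>}. \<bar>signed_kernel V m n relative_sign \<sigma> \<sigma>'\<bar>)
      \<le> sup_norm top_simplices (line_degree V m n)" if "\<sigma> \<in> top_simplices" for \<sigma>
    using sup_norm_bounds(2)[OF bounded_degree that] by (simp add: abs_row_sum_signed_kernel)
qed (use finite_line_neighbours signed_kernel_sym sup_norm_bounds(1)[OF bounded_degree] in
    \<open>auto simp: line_adjacent_def\<close>)

lemma closed_line_neighbours_eq: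
  "\<sigma> \<in> top_simplices \<Longrightarrow> closed_line_neighbours \<sigma> = insert \<sigma> {\<sigma>'. line_adjacent V m n \<sigma>' \<sigma>}"
  by (auto simp: closed_line_neighbours_def)

lemma line_kernel_off_diagonal:
  "line_adjacent V m n \<sigma>' \<sigma> \<Longrightarrow> line_kernel \<sigma> \<sigma>' = signed_kernel V m n relative_sign \<sigma> \<sigma>'"
  by (auto simp: line_kernel_def line_adjacent_def)

lemma not_line_adjacent_self: "\<not> line_adjacent V m n \<sigma> \<sigma>"
  by (simp add: line_adjacent_def)

sublocale schroedinger: locally_finite_kernel top_simplices closed_line_neighbours line_kernel norm_bound
proof
  show "finite (closed_line_neighbours \<sigma>)" for \<sigma>
    by (simp add: closed_line_neighbours_def finite_line_neighbours)
  show "closed_line_neighbours \<sigma> \<subseteq> top_simplices" for \<sigma>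
    by (auto simp: closed_line_neighbours_def line_adjacent_def)
  show "\<sigma> \<in> closed_line_neighbours \<sigma>'" if "\<sigma>' \<in> closed_line_neighbours \<sigma>" for \<sigma> \<sigma>'
    using that by (auto simp: closed_line_neighbours_def line_adjacent_sym[of \<sigma>])
  show "line_kernel \<sigma> \<sigma>' = line_kernel \<sigma>' \<sigma>" for \<sigma> \<sigma>'
    by (auto simp: line_kernel_def signed_kernel_sym[of \<sigma>])
  show "0 \<le> norm_bound"
    using sup_norm_bounds(1)[OF bounded_degree] sup_norm_bounds(1)[OF bounded_potential]
    by (simp add: norm_bound_def)
  show "(\<Sum>\<sigma>'\<in>closed_line_neighbours \<sigma>. \<bar>line_kernel \<sigma> \<sigma>'\<bar>) \<le> norm_bound" if \<sigma>: "\<sigma> \<in> top_simplices" for \<sigma>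
  proof -
    have "(\<Sum>\<sigma>'\<in>closed_line_neighbours \<sigma>. \<bar>line_kernel \<sigma> \<sigma>'\<bar>)
        = \<bar>line_kernel \<sigma> \<sigma>\<bar> + (\<Sum>\<sigma>' | line_adjacent V m n \<sigma>' \<sigma>. \<bar>line_kernel \<sigma> \<sigma>'\<bar>)"
      using finite_line_neighbours not_line_adjacent_self by (simp add: closed_line_neighbours_eq[OF \<sigma>])
    also have "\<dots> = \<bar>simplex_potential m n \<sigma>\<bar> + line_degree V m n \<sigma>"
      by (simp add: line_kernel_off_diagonal flip: abs_row_sum_signed_kernel) (simp add: line_kernel_def)
    also have "\<dots> \<le> norm_bound"
      using sup_norm_bounds(2)[OF bounded_degree \<sigma>] sup_norm_bounds(2)[OF bounded_potential \<sigma>]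
      by (simp add: norm_bound_def)
    finally show ?thesis .
  qed
qed

lemma signed_adjacency_self_adjoint: "self_adjoint L (vecs L) (signed_adjacency V m n relative_sign)"
proof -
  have "adjacency.kernel_operator = signed_adjacency V m n relative_sign"
    by (intro ext) (simp add: adjacency.kernel_operator_def signed_adjacency_def)
  then show ?thesis using adjacency.self_adjoint_B by simp
qed

lemma line_operator_eq:
  assumes f: "f \<in> vecs L"
  shows "schroedinger.kernel_operator f = line_operator f"
proof
  fix \<sigma>
  show "schroedinger.kernel_operator f \<sigma> = line_operator f \<sigma>"
  proof (cases "\<sigma> \<in> top_simplices")
    case True
    then show ?thesis
      using finite_line_neighbours not_line_adjacent_self
      by (simp add: schroedinger.kernel_operator_def closed_line_neighbours_eq line_operator_def
          signed_adjacency_def multiplication_def line_kernel_off_diagonal) (simp add: line_kernel_def)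
  next
    case False
    then have "\<not> line_adjacent V m n \<sigma>' \<sigma>" for \<sigma>' by (simp add: line_adjacent_def)
    with False f show ?thesis
      by (simp add: schroedinger.kernel_operator_outside line_operator_def signed_adjacency_def
          multiplication_def vecs_l2_counting)
  qed
qed

text \<open>The bounded extension of the Hodge Laplacian, defined by transporting the operator of the
  line-complex back along the unitary.\<close>

definition extended_laplacian :: "('v list set \<Rightarrow> complex) \<Rightarrow> 'v list set \<Rightarrow> complex" where
  "extended_laplacian f = from_line (schroedinger.kernel_operator (to_line f))"

lemma to_line_mem: "f \<in> vecs H \<Longrightarrow> to_line f \<in> vecs L"
  by (simp add: vecs_l2_cochains_iff)

lemma extended_laplacian_mem: "f \<in> vecs H \<Longrightarrow> extended_laplacian f \<in> vecs H"
  by (simp add: extended_laplacian_def from_line_mem schroedinger.B_mem to_line_mem)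

lemma to_line_extended_laplacian:
  "f \<in> vecs H \<Longrightarrow> to_line (extended_laplacian f) = schroedinger.kernel_operator (to_line f)"
  by (simp add: extended_laplacian_def to_line_from_line_l2 schroedinger.B_mem to_line_mem)

sublocale laplacian: bounded_symmetric_restriction H extended_laplacian norm_bound
  "finite_cochains V m n" "hodge_laplacian V m n"
proof
  have "extended_laplacian (\<lambda>x. a * f x + b * g x)
      = (\<lambda>x. a * extended_laplacian f x + b * extended_laplacian g x)" for f g a b
    by (simp add: extended_laplacian_def to_line_lincomb schroedinger.kernel_operator_lincomb from_line_lincomb)
  then show "linear_operator H (vecs H) extended_laplacian"
    using extended_laplacian_mem cochain_space.zero_mem cochain_space.lincomb_mem
    by (auto simp: linear_operator_def linear_on_def)
  show "0 \<le> norm_bound" by (rule schroedinger.row_bound_nonneg)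
  show "vnorm H (extended_laplacian f) \<le> norm_bound * vnorm H f" if "f \<in> vecs H" for f
    using that schroedinger.bound_B[OF to_line_mem[OF that]]
    by (simp add: to_line_extended_laplacian extended_laplacian_mem flip: vnorm_to_line)
  show "ip H (extended_laplacian f) g = ip H f (extended_laplacian g)" if "f \<in> vecs H" "g \<in> vecs H" for f g
    using that schroedinger.symmetric_B[OF to_line_mem to_line_mem, of f g]
    by (simp add: to_line_extended_laplacian extended_laplacian_mem flip: to_line_isometric)
  show "dense_in H (finite_cochains V m n)" by (rule finite_cochains_dense)
  show "(\<lambda>x. 0) \<in> finite_cochains V m n" by (simp add: finite_cochains_def zero_cochain)
  show "hodge_laplacian V m n f = extended_laplacian f" if f: "f \<in> finite_cochains V m n" for f
  proof -
    have fH: "f \<in> vecs H" and fc: "f \<in> cochains V m n"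
      using f finite_cochains_dense by (auto simp: dense_in_def finite_cochains_def)
    have "to_line (hodge_laplacian V m n f) = to_line (extended_laplacian f)"
      unfolding to_line_extended_laplacian[OF fH] line_operator_eq[OF to_line_mem[OF fH]]
      by (simp add: to_line_hodge_laplacian[OF fc] line_operator_def[abs_def])
    then show ?thesis
      using inj_on_to_line hodge_laplacian_cochain[OF fc] extended_laplacian_mem[OF fH]
      by (auto simp: vecs_l2_cochains_iff dest: inj_onD)
  qed
qed (rule finite_cochains_lincomb)

lemma conjugated_laplacian:
  assumes "f \<in> to_line ` finite_cochains V m n"
  shows "to_line (hodge_laplacian V m n (inv_into (vecs H) to_line f)) = line_operator f"
proof -
  obtain g where g: "g \<in> finite_cochains V m n" "f = to_line g" using assms by blast
  have "inv_into (vecs H) to_line f = g"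
    using g laplacian.D_mem inj_on_to_line_l2 by (simp add: inv_into_f_f)
  then show ?thesis
    using g to_line_hodge_laplacian[of g] by (simp add: line_operator_def[abs_def] finite_cochains_def)
qed

lemma conjugated_extension:
  assumes B: "bounded_extension H (finite_cochains V m n) (hodge_laplacian V m n) B" and f: "f \<in> vecs L"
  shows "to_line (B (inv_into (vecs H) to_line f)) = line_operator f"
  using laplacian.bounded_extension_unique[OF B from_line_mem[OF f]] f
  by (simp add: inv_into_to_line to_line_extended_laplacian from_line_mem to_line_from_line_l2 line_operator_eq)

end

theorem theorem6p3:
  fixes V :: "'v set" and m :: "nat \<Rightarrow> 'v list \<Rightarrow> real" and n :: nat
  assumes "weighted_complex V m n"
    and "locally_finite V m"
    and A1: "bounded (line_degree V m n ` unoriented_simplices V m n)"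
    and A2: "bounded (simplex_potential m n ` unoriented_simplices V m n)"
  shows
    "(\<forall>\<omega>. reference_orientation V m n \<omega> \<longrightarrow>
      (\<exists>U \<theta> \<eta>.
        unitary (l2_cochains V m n) (l2_counting (unoriented_simplices V m n)) U \<and>
        (\<forall>\<sigma>\<in>unoriented_simplices V m n. \<forall>f\<in>vecs (l2_cochains V m n).
           (\<forall>s\<in>oriented_simplices V m n. underlying s \<noteq> \<sigma> \<longrightarrow> f s = 0) \<longrightarrow>
           (\<forall>\<sigma>'\<in>unoriented_simplices V m n. \<sigma>' \<noteq> \<sigma> \<longrightarrow> U f \<sigma>' = 0)) \<and>
        coboundary_coefficients V m n \<omega> \<theta> \<and>
        (\<forall>\<sigma> \<sigma>'. line_adjacent V m n \<sigma> \<sigma>' \<longrightarrow>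
           \<eta> \<sigma> \<sigma>' = \<theta> (\<sigma> \<inter> \<sigma>') \<sigma> * \<theta> (\<sigma> \<inter> \<sigma>') \<sigma>' \<and>
           \<eta> \<sigma> \<sigma>' = \<eta> \<sigma>' \<sigma> \<and> \<eta> \<sigma> \<sigma>' \<in> {-1, 1}) \<and>
        self_adjoint (l2_counting (unoriented_simplices V m n))
          (vecs (l2_counting (unoriented_simplices V m n))) (signed_adjacency V m n \<eta>) \<and>
        (\<forall>\<sigma>\<in>unoriented_simplices V m n. \<forall>\<sigma>'\<in>unoriented_simplices V m n.
           signed_kernel V m n \<eta> \<sigma> \<sigma>' = signed_kernel V m n \<eta> \<sigma>' \<sigma> \<and>
           \<bar>signed_kernel V m n \<eta> \<sigma> \<sigma>'\<bar> = line_weight V m n \<sigma> \<sigma>') \<and>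
        (\<forall>f\<in>U ` finite_cochains V m n.
           U (hodge_laplacian V m n (inv_into (vecs (l2_cochains V m n)) U f)) =
           (\<lambda>\<sigma>. signed_adjacency V m n \<eta> f \<sigma> + multiplication (simplex_potential m n) f \<sigma>)) \<and>
        (\<forall>B. bounded_extension (l2_cochains V m n) (finite_cochains V m n)
               (hodge_laplacian V m n) B \<longrightarrow>
           (\<forall>f\<in>vecs (l2_counting (unoriented_simplices V m n)).
              U (B (inv_into (vecs (l2_cochains V m n)) U f)) =
              (\<lambda>\<sigma>. signed_adjacency V m n \<eta> f \<sigma>
                     + multiplication (simplex_potential m n) f \<sigma>))))) \<and>
     bounded_operator (l2_cochains V m n) (finite_cochains V m n) (hodge_laplacian V m n) \<and>
     op_norm (l2_cochains V m n) (finite_cochains V m n) (hodge_laplacian V m n)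
       \<le> sup_norm (unoriented_simplices V m n) (line_degree V m n)
         + sup_norm (unoriented_simplices V m n) (simplex_potential m n) \<and>
     (\<exists>B. bounded_extension (l2_cochains V m n) (finite_cochains V m n)
            (hodge_laplacian V m n) B \<and>
          self_adjoint (l2_cochains V m n) (vecs (l2_cochains V m n)) B \<and>
          (\<forall>B'. bounded_extension (l2_cochains V m n) (finite_cochains V m n)
                  (hodge_laplacian V m n) B' \<longrightarrow>
             (\<forall>f\<in>vecs (l2_cochains V m n). B' f = B f))) \<and>
     essentially_self_adjoint (l2_cochains V m n) (finite_cochains V m n) (hodge_laplacian V m n)"
proof -
  have bounded_complex: "bounded_oriented_complex V m n \<omega>" if "reference_orientation V m n \<omega>" for \<omega>
    using assms that
    by (simp add: bounded_oriented_complex_def oriented_complex_def oriented_complex_axioms_def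
        bounded_oriented_complex_axioms_def locally_finite_def)
  obtain \<omega>\<^sub>0 where \<omega>\<^sub>0: "reference_orientation V m n \<omega>\<^sub>0"
    using weighted_complex.reference_orientation_exists[OF assms(1)] by blast
  \<comment> \<open>The claims on the Laplacian do not mention an orientation; any reference orientation serves to
    prove them.\<close>
  interpret ref: bounded_oriented_complex V m n \<omega>\<^sub>0 by (rule bounded_complex[OF \<omega>\<^sub>0])
  show ?thesis
  proof (intro conjI allI impI, goal_cases)
    case (1 \<omega>)
    interpret bounded_oriented_complex V m n \<omega> by (rule bounded_complex[OF 1])
    have support: "\<forall>\<sigma>\<in>unoriented_simplices V m n. \<forall>f\<in>vecs (l2_cochains V m n).
        (\<forall>s\<in>oriented_simplices V m n. underlying s \<noteq> \<sigma> \<longrightarrow> f s = 0) \<longrightarrow>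
        (\<forall>\<sigma>'\<in>unoriented_simplices V m n. \<sigma>' \<noteq> \<sigma> \<longrightarrow> to_line f \<sigma>' = 0)"
      using to_line_support by blast
    show ?case
      by (rule exI[of _ to_line], rule exI[of _ incidence], rule exI[of _ relative_sign])
        (intro conjI unitary_to_line support coboundary_coefficients_incidence
          signed_adjacency_self_adjoint allI ballI impI relative_sign_def relative_sign_sym
          relative_sign_unit signed_kernel_sym abs_signed_kernel
          conjugated_laplacian[unfolded line_operator_def[abs_def]]
          conjugated_extension[unfolded line_operator_def[abs_def]]; assumption)
  next
    case 2
    show ?case by (rule ref.laplacian.bounded_A)
  next
    case 3
    show ?case using ref.laplacian.op_norm_A by (simp add: ref.norm_bound_def)
  next
    case 4
    show ?case
      using ref.laplacian.bounded_extension_B ref.laplacian.self_adjoint_B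
        ref.laplacian.bounded_extension_unique by blast
  next
    case 5
    show ?case by (rule ref.laplacian.essentially_self_adjoint_A)
  qed
qed

end
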